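(* Let $a,b,c,d$ be independent (complex) parameters and let $\tilde\varphi:\mathbb{C}\mathbb{P}_3\dashrightarrow\mathbb{C}\mathbb{P}_3$ be the birational map $[x,y,z,t]\mapsto[x',y',z',t']$ given by $$x'=-a\,t^2-b\,(x+y)\,t-c\,(x+y+z)\,t-d\,(x+y)(2x+2y+z),$$ $$y'=x\,(c\,t+d(x+y)),\qquad z'=y\,(c\,t+d(x+y)),\qquad t'=t\,(c\,t+d(x+y)).$$ Let $d_n$ denote the degree of the $n$-th iterate of $\tilde\varphi$. Then for all $n\ge 0$ $$d_n=\frac{17}{16}+\frac{5}{12}\,n+\frac{3}{8}\,n^2+\frac{1}{12}\,n^3-\frac{1}{16}\,(-1)^n .$$
   Context: The parameters $a,b,c,d$ are independent, i.e. they satisfy no algebraic relation (generic parameters). The $n$-th iterate $\tilde\varphi^n$ is understood in regularised form: it is written with four homogeneous polynomials of the same degree in $x,y,z,t$, from which all common factors have been removed. The degree $d_n$ (not to be confused with the parameter $d$) is the common degree of these four polynomials; $\tilde\varphi^0$ is the identity, so $d_0=1$. *)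

theory Defs
  imports
    Complex_Main
    "HOL-Computational_Algebra.Polynomial_Factorial"
    "HOL-Computational_Algebra.Field_as_Ring"
begin

section \<open>Polynomials over the complex numbers in four variables\<close>

text \<open>
  The ring C[x,y,z,t] is rendered as C[x][y][z][t]: the innermost variable is x, the outermost t.
  This gives the library's factorial ring structure with \<open>gcd\<close>.
\<close>

type_synonym cpoly4 = "complex poly poly poly poly"

definition var_x :: cpoly4 where "var_x = [:[:[:[:0, 1:]:]:]:]"
definition var_y :: cpoly4 where "var_y = [:[:[:0, 1:]:]:]"
definition var_z :: cpoly4 where "var_z = [:[:0, 1:]:]"
definition var_t :: cpoly4 where "var_t = [:0, 1:]"

definition const4 :: "complex \<Rightarrow> cpoly4" where
  "const4 c = [:[:[:[:c:]:]:]:]"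

text \<open>The coefficient of the monomial \<open>x^i * y^j * z^k * t^l\<close>.\<close>

definition coeff4 :: "cpoly4 \<Rightarrow> nat \<Rightarrow> nat \<Rightarrow> nat \<Rightarrow> nat \<Rightarrow> complex" where
  "coeff4 p i j k l = coeff (coeff (coeff (coeff p l) k) j) i"

text \<open>As usual, the zero polynomial is homogeneous of every degree.\<close>

definition homogeneous4 :: "nat \<Rightarrow> cpoly4 \<Rightarrow> bool" where
  "homogeneous4 m p \<longleftrightarrow> (\<forall>i j k l. coeff4 p i j k l \<noteq> 0 \<longrightarrow> i + j + k + l = m)"

definition eval4 :: "cpoly4 \<Rightarrow> complex \<Rightarrow> complex \<Rightarrow> complex \<Rightarrow> complex \<Rightarrow> complex" where
  "eval4 p x y z t = poly (poly (poly (poly p [:[:[:t:]:]:]) [:[:z:]:]) [:y:]) x"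

lemma eval4_monomial:
  "eval4 (const4 c * var_x ^ i * var_y ^ j * var_z ^ k * var_t ^ l) x y z t
     = c * x ^ i * y ^ j * z ^ k * t ^ l"
  by (simp add: eval4_def const4_def var_x_def var_y_def var_z_def var_t_def poly_power)

text \<open>
  Independence of the parameters: they satisfy no nontrivial polynomial relation with rational
  coefficients.
\<close>

definition independent4 :: "complex \<Rightarrow> complex \<Rightarrow> complex \<Rightarrow> complex \<Rightarrow> bool" where
  "independent4 a b c d \<longleftrightarrow>
     (\<forall>p. p \<noteq> 0 \<and> (\<forall>i j k l. coeff4 p i j k l \<in> \<rat>) \<longrightarrow> eval4 p a b c d \<noteq> 0)"


section \<open>The map and its regularised iterates\<close>

text \<open>
  The map in homogeneous coordinates, over an arbitrary commutative ring. Applied to a quadruple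
  of polynomials it substitutes them for the coordinates, so that iterating it on the quadruple of
  the four variables composes the map with itself.
\<close>

fun phi :: "'r::comm_ring_1 \<Rightarrow> 'r \<Rightarrow> 'r \<Rightarrow> 'r \<Rightarrow> 'r \<times> 'r \<times> 'r \<times> 'r \<Rightarrow> 'r \<times> 'r \<times> 'r \<times> 'r" where
  "phi a b c d (x, y, z, t) =
     (- a * t^2 - b * (x + y) * t - c * (x + y + z) * t - d * (x + y) * (2 * x + 2 * y + z),
      x * (c * t + d * (x + y)),
      y * (c * t + d * (x + y)),
      t * (c * t + d * (x + y)))"

definition phi_iterate ::
    "complex \<Rightarrow> complex \<Rightarrow> complex \<Rightarrow> complex \<Rightarrow> nat \<Rightarrow> cpoly4 \<times> cpoly4 \<times> cpoly4 \<times> cpoly4" where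
  "phi_iterate a b c d n =
     (phi (const4 a) (const4 b) (const4 c) (const4 d) ^^ n) (var_x, var_y, var_z, var_t)"

text \<open>Removal of all common factors from the homogeneous coordinates of a rational map.\<close>

fun regularise :: "cpoly4 \<times> cpoly4 \<times> cpoly4 \<times> cpoly4 \<Rightarrow> cpoly4 \<times> cpoly4 \<times> cpoly4 \<times> cpoly4" where
  "regularise (p, q, r, s) =
     (let g = gcd p (gcd q (gcd r s)) in (p div g, q div g, r div g, s div g))"

fun homogeneous_quad :: "nat \<Rightarrow> cpoly4 \<times> cpoly4 \<times> cpoly4 \<times> cpoly4 \<Rightarrow> bool" where
  "homogeneous_quad m (p, q, r, s) \<longleftrightarrow>
     homogeneous4 m p \<and> homogeneous4 m q \<and> homogeneous4 m r \<and> homogeneous4 m s"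

text \<open>
  The common degree of the four coordinates of the regularised iterate. It is unique as soon as
  one coordinate is nonzero.
\<close>

definition iterate_degree :: "complex \<Rightarrow> complex \<Rightarrow> complex \<Rightarrow> complex \<Rightarrow> nat \<Rightarrow> nat" where
  "iterate_degree a b c d n =
     (THE m. homogeneous_quad m (regularise (phi_iterate a b c d n)))"

end

theory Submission
  imports Defs "HOL-Computational_Algebra.Fundamental_Theorem_Algebra"
begin

text \<open>
  Let \<open>x\<^sub>n\<close> be the affine coordinate \<open>x/t\<close> of the \<open>n\<close>-th iterate; its coordinates \<open>y/t\<close> and \<open>z/t\<close> are
  \<open>x\<^sub>n\<^sub>-\<^sub>1\<close> and \<open>x\<^sub>n\<^sub>-\<^sub>2\<close>. Then \<open>w\<^sub>n = x\<^sub>n + x\<^sub>n\<^sub>-\<^sub>1 + c/d\<close> satisfies the integrable recurrence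
  \<open>w\<^sub>n\<^sub>+\<^sub>1 + w\<^sub>n + w\<^sub>n\<^sub>-\<^sub>1 = \<alpha> + \<beta> / w\<^sub>n\<close>.
  The singularities of the recurrence are confined in the pattern \<open>0, \<infinity>, \<infinity>, 0\<close>, so
  \<open>w\<^sub>n = \<tau>\<^sub>n \<tau>\<^sub>n\<^sub>-\<^sub>3 / (\<tau>\<^sub>n\<^sub>-\<^sub>1 \<tau>\<^sub>n\<^sub>-\<^sub>2 t)\<close> with polynomials \<open>\<tau>\<^sub>n\<close>. Because of the conserved quantity of the
  recurrence these form a Somos-5 sequence, and their degrees grow quadratically. Each zero of some
  \<open>w\<^sub>m\<close> becomes a pole of all \<open>x\<^sub>n\<close> with \<open>n > m\<close>, so that the reduced denominator of \<open>x\<^sub>n\<close>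
  is \<open>t \<tau>\<^sub>0 \<dots> \<tau>\<^sub>n\<^sub>-\<^sub>1\<close>, whose degree is the claimed cubic.

  The crucial point is that the \<open>\<tau>\<^sub>n\<close> are pairwise coprime. Modulo a prime factor of \<open>\<tau>\<^sub>m\<close>, the orbit
  after the confined singularity is \<open>0, s, \<alpha> + \<beta>/s - s, \<dots>\<close> with \<open>s = - I / \<beta>\<close>, where \<open>I\<close> is the conserved
  quantity. This \<open>s\<close> is transcendental over the constants, as otherwise running
  the recurrence backwards would make \<open>w\<^sub>0\<close> and \<open>w\<^sub>-\<^sub>1\<close> constant modulo the prime; and by its asymptotics
  for \<open>s \<rightarrow> \<infinity>\<close> the orbit of \<open>0, s\<close> never returns to \<open>0\<close>.
\<close>

section \<open>Somos-5 sequences\<close>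

lemma coprimeI_primes:
  fixes a b :: "'a::factorial_ring_gcd"
  assumes "a \<noteq> 0 \<or> b \<noteq> 0" "\<And>p. prime_elem p \<Longrightarrow> p dvd a \<Longrightarrow> p dvd b \<Longrightarrow> False"
  shows "coprime a b"
proof (rule ccontr)
  assume "\<not> coprime a b"
  hence "\<not> is_unit (gcd a b)" using is_unit_gcd by blast
  moreover have "gcd a b \<noteq> 0" using assms(1) by simp
  ultimately obtain p where "prime p" "p dvd gcd a b" using prime_divisor_exists by blast
  thus False using assms(2)[of p] by (auto simp: prime_def)
qed

text \<open>The Laurent phenomenon in one identity: eliminating \<open>n8\<close> and
  \<open>n7\<close> by \<open>h1\<close> and \<open>h2\<close> leaves, modulo \<open>m\<close>, a
  multiple of \<open>n5^2 * q2^2 + n6 * q3^2 * q2\<close>, which \<open>h3\<close> kills. Here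
  \<open>m\<close> is an entry of the sequence, the \<open>q\<close> are entries before it, the
  \<open>n\<close> entries after it, and \<open>B\<close> is \<open>\<beta> * t^2\<close>.\<close>

lemma somos5_divisibility:
  fixes m :: "'a::comm_ring_1"
  assumes h1: "n8 * q3 = - B * n7 * m - J * n6 * n5"
    and h2: "n7 * q2 = - B * n6 * q3 - J * n5 * m"
    and h3: "n6 * q3^2 * q2 = - (n5^2 * q2^2) - m * e"
  shows "m dvd q3 * q2^2 * (- B * n8 * n5 - J * n7 * n6)"
proof -
  have "q3 * q2^2 * (- B * n8 * n5 - J * n7 * n6) = - B * n5 * q2^2 * (n8 * q3) - J * n6 * q3 * q2 * (n7 * q2)"
    by (simp add: algebra_simps power2_eq_square)
  also have "\<dots> = m * (B^2 * n5 * n7 * q2^2 + J^2 * n6 * q3 * q2 * n5) + B * J * n6 * (n5^2 * q2^2 + n6 * q3^2 * q2)"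
    unfolding h1 h2 by (simp add: algebra_simps power2_eq_square)
  also have "n5^2 * q2^2 + n6 * q3^2 * q2 = - (m * e)"
    unfolding h3 by simp
  also have "m * (B^2 * n5 * n7 * q2^2 + J^2 * n6 * q3 * q2 * n5) + B * J * n6 * (- (m * e))
      = m * (B^2 * n5 * n7 * q2^2 + J^2 * n6 * q3 * q2 * n5 - B * J * n6 * e)"
    by (simp add: algebra_simps power2_eq_square)
  finally show ?thesis by simp
qed

locale somos5 =
  fixes U V t \<alpha> \<beta> :: "'a::factorial_ring_gcd"
  assumes prime_t: "prime_elem t"
    and t_ndvd: "\<not> t dvd U * V * (U + V)"
    and unit_\<beta>: "is_unit \<beta>"
begin

text \<open>\<open>J / t^3\<close> is the conserved quantity of the recurrence at the initial pair
  \<open>V / t\<close>, \<open>U / t\<close>.\<close>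

definition J :: 'a where "J = U * V * (U + V - \<alpha> * t) - \<beta> * t^2 * (U + V)"

text \<open>
  The index is shifted: \<open>sg k\<close> is \<open>\<tau>\<close> with index \<open>k - 4\<close>. The first entry \<open>V\<close> is \<open>t\<close> times the \<open>w\<close> preceding
  the initial one, and the initial one is \<open>U / t\<close>. The division by \<open>sg k\<close> turns out to be exact.
\<close>

fun sg :: "nat \<Rightarrow> 'a" where
  "sg 0 = V"
| "sg (Suc 0) = 1"
| "sg (Suc (Suc 0)) = 1"
| "sg (Suc (Suc (Suc 0))) = 1"
| "sg (Suc (Suc (Suc (Suc 0)))) = U"
| "sg (Suc (Suc (Suc (Suc (Suc k))))) =
     (- \<beta> * t^2 * sg (Suc (Suc (Suc (Suc k)))) * sg (Suc k) - J * sg (Suc (Suc (Suc k))) * sg (Suc (Suc k))) div sg k"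

lemma sg_init: "sg 1 = 1" "sg 2 = 1" "sg 3 = 1" "sg 4 = U"
  by (simp_all add: eval_nat_numeral)

lemma sg_step: "sg (k + 5) = (- \<beta> * t^2 * sg (k + 4) * sg (k + 1) - J * sg (k + 3) * sg (k + 2)) div sg k"
  by (simp add: eval_nat_numeral)

definition somos_rel :: "nat \<Rightarrow> bool" where
  "somos_rel k \<longleftrightarrow> sg (k + 5) * sg k = - \<beta> * t^2 * sg (k + 4) * sg (k + 1) - J * sg (k + 3) * sg (k + 2)"

text \<open>
  With \<open>w\<^sub>k = sg (k + 3) * sg k / (sg (k + 2) * sg (k + 1) * t)\<close>, the relations \<open>sum_rel\<close>, \<open>somos_rel\<close> and
  \<open>invariant_rel\<close> are the recurrence
  \<open>w\<^sub>k\<^sub>+\<^sub>2 + w\<^sub>k\<^sub>+\<^sub>1 + w\<^sub>k = \<alpha> + \<beta> / w\<^sub>k\<^sub>+\<^sub>1\<close>, the product form \<open>w\<^sub>k\<^sub>+\<^sub>2 w\<^sub>k\<^sub>+\<^sub>1 w\<^sub>k = - \<beta> w\<^sub>k\<^sub>+\<^sub>1 - J / t\<^sup>3\<close>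
  and the conservation law \<open>w\<^sub>k w\<^sub>k\<^sub>+\<^sub>1 (w\<^sub>k + w\<^sub>k\<^sub>+\<^sub>1 - \<alpha>) - \<beta> (w\<^sub>k + w\<^sub>k\<^sub>+\<^sub>1) = J / t\<^sup>3\<close>, cleared of denominators.
\<close>

definition sum_rel :: "nat \<Rightarrow> bool" where
  "sum_rel k \<longleftrightarrow> sg (k + 5) * sg (k + 2)^2 * sg (k + 1) =
     - (sg (k + 4)^2 * sg (k + 1)^2) - sg (k + 4) * sg (k + 3)^2 * sg k
     + \<alpha> * t * sg (k + 4) * sg (k + 3) * sg (k + 2) * sg (k + 1)
     + \<beta> * t^2 * sg (k + 3)^2 * sg (k + 2)^2"

definition invariant_rel :: "nat \<Rightarrow> bool" where
  "invariant_rel k \<longleftrightarrow>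
     sg (k + 4) * sg k * (sg (k + 3)^2 * sg k + sg (k + 4) * sg (k + 1)^2 - \<alpha> * t * sg (k + 1) * sg (k + 2) * sg (k + 3))
     - \<beta> * t^2 * sg (k + 2)^2 * (sg (k + 3)^2 * sg k + sg (k + 4) * sg (k + 1)^2)
     = J * sg (k + 1) * sg (k + 2)^3 * sg (k + 3)"

lemma t_ndvd_J: "\<not> t dvd J"
proof
  assume "t dvd J"
  moreover have "U * V * (U + V) = J + t * (U * V * \<alpha> + \<beta> * t * (U + V))"
    unfolding J_def by algebra
  ultimately have "t dvd U * V * (U + V)" by (metis dvd_add dvd_triv_left)
  with t_ndvd show False by simp
qed

lemma t_ndvd_U: "\<not> t dvd U" and t_ndvd_V: "\<not> t dvd V"
  using t_ndvd by (auto intro: dvd_mult dvd_mult2)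

lemma t_neq0: "t \<noteq> 0"
  using prime_t by auto

lemma ndvd_neq0: "\<not> (p::'a) dvd q \<Longrightarrow> q \<noteq> 0"
  by auto

lemma invariant_rel_0: "invariant_rel 0"
  unfolding invariant_rel_def J_def using sg_init by (simp add: algebra_simps)

text \<open>Eliminating \<open>J\<close> between the product form and the conservation law and
  dividing by the product of two consecutive w leaves the sum form.\<close>

lemma sum_rel_step: assumes "somos_rel k" "invariant_rel k" "sg k \<noteq> 0" shows "sum_rel k"
proof -
  have "sg k * (sg (k + 5) * sg (k + 2)^2 * sg (k + 1)) = sg k * (
     - (sg (k + 4)^2 * sg (k + 1)^2) - sg (k + 4) * sg (k + 3)^2 * sg k
     + \<alpha> * t * sg (k + 4) * sg (k + 3) * sg (k + 2) * sg (k + 1)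
     + \<beta> * t^2 * sg (k + 3)^2 * sg (k + 2)^2)"
    using assms(1,2) unfolding somos_rel_def invariant_rel_def by algebra
  with assms(3) show ?thesis unfolding sum_rel_def by simp
qed

text \<open>The sum form turns the first bracket, times \<open>a1\<close>, into
  \<open>a3^2 * (B * a2^2 - a4 * a0)\<close>; the product form then brings in \<open>j\<close>. The
  letters stand for consecutive entries, \<open>B\<close> for \<open>\<beta> * t^2\<close> and
  \<open>C\<close> for \<open>\<alpha> * t\<close>.\<close>

lemma invariant_step:
  fixes a0 :: "'b::comm_ring_1"
  assumes S: "a5 * a0 = - B * a4 * a1 - j * a3 * a2"
    and E: "a5 * a2^2 * a1 = - (a4^2 * a1^2) - a4 * a3^2 * a0 + C * a4 * a3 * a2 * a1 + B * a3^2 * a2^2"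
  shows "a5 * a1 * (a4^2 * a1 + a5 * a2^2 - C * a2 * a3 * a4) - B * a3^2 * (a4^2 * a1 + a5 * a2^2)
    = j * a2 * a3^3 * a4"
proof -
  have "a1 * (a4^2 * a1 + a5 * a2^2 - C * a2 * a3 * a4) = a3^2 * (B * a2^2 - a4 * a0)"
    using E by (simp add: algebra_simps power2_eq_square)
  hence "a5 * a1 * (a4^2 * a1 + a5 * a2^2 - C * a2 * a3 * a4) = a5 * (a3^2 * (B * a2^2 - a4 * a0))"
    by (simp add: mult.assoc)
  also have "\<dots> - B * a3^2 * (a4^2 * a1 + a5 * a2^2) = - (a3^2 * a4) * (a5 * a0 + B * a4 * a1)"
    by (simp add: algebra_simps power2_eq_square)
  also have "\<dots> = j * a2 * a3^3 * a4"
    unfolding S by (simp add: algebra_simps power2_eq_square power3_eq_cube)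
  finally show ?thesis .
qed

lemma invariant_rel_step: assumes "somos_rel k" "sum_rel k" shows "invariant_rel (Suc k)"
proof -
  have e: "Suc k = k + 1" "k + 1 + 1 = k + 2" "k + 1 + 2 = k + 3" "k + 1 + 3 = k + 4" "k + 1 + 4 = k + 5"
    by auto
  show ?thesis unfolding invariant_rel_def e
    by (rule invariant_step[of _ "sg k"]) (use assms in \<open>unfold somos_rel_def sum_rel_def, simp_all only: mult_minus_left\<close>)
qed

section \<open>Exact division and coprimality of nearby entries\<close>

lemma prime_ndvd_\<beta>: "prime_elem p \<Longrightarrow> \<not> p dvd \<beta>"
  using unit_\<beta> by (meson dvd_trans prime_elem_not_unit)

text \<open>A prime dividing the prime \<open>t\<close> is associated with it. This is how prime
  factors of \<open>t\<close> are excluded later.\<close>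

lemma prime_common:
  assumes "prime_elem p" "p dvd t" "p dvd q" shows "t dvd q"
proof -
  from assms(2) obtain r where r: "t = p * r" by (auto elim: dvdE)
  have "r dvd 1" using prime_elem_imp_irreducible[OF prime_t] r assms(1)
    by (metis irreducibleD prime_elem_not_unit)
  hence "t dvd p" using r by (metis dvd_refl mult_unit_dvd_iff)
  with assms(3) show ?thesis by (rule dvd_trans[rotated])
qed

text \<open>The claims support each other in one induction: exact division by \<open>sg k\<close>
  needs coprimality with the two entries before it, coprimality of a new entry needs
  \<open>sum_rel\<close>, and that needs \<open>somos_rel\<close>, the invariant and
  \<open>sg k\<close> nonzero, which non-divisibility by \<open>t\<close> provides.\<close>

lemma sg_all:
  "(\<forall>i<k. somos_rel i) \<and> invariant_rel k \<and> (\<forall>i<k+5. \<not> t dvd sg i) \<and>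
   (\<forall>i\<ge>1. i < k + 4 \<longrightarrow> coprime (sg (i + 1)) (sg i)) \<and>
   (\<forall>i\<ge>1. i < k + 3 \<longrightarrow> coprime (sg (i + 2)) (sg i))"
proof (induction k)
  case 0
  have nt1: "\<not> t dvd 1" using prime_t by auto
  have "\<not> t dvd sg i" if "i < 5" for i
  proof -
    from that have "i = 0 \<or> i = 1 \<or> i = 2 \<or> i = 3 \<or> i = 4" by auto
    thus ?thesis using sg_init t_ndvd_U t_ndvd_V nt1 by (elim disjE) (simp_all only: sg.simps not_False_eq_True)
  qed
  moreover have "coprime (sg (i + 1)) (sg i)" if "i \<ge> 1" "i < 4" for i
  proof -
    from that have "i = 1 \<or> i = 2 \<or> i = 3" by auto
    thus ?thesis using sg_init by (elim disjE) (simp_all add: eval_nat_numeral)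
  qed
  moreover have "coprime (sg (i + 2)) (sg i)" if "i \<ge> 1" "i < 3" for i
  proof -
    from that have "i = 1 \<or> i = 2" by auto
    thus ?thesis using sg_init by (elim disjE) (simp_all add: eval_nat_numeral)
  qed
  ultimately show ?case using invariant_rel_0 by auto
next
  case (Suc k)
  hence S: "somos_rel i" if "i < k" for i using that by auto
  from Suc have I: "invariant_rel k" by auto
  from Suc have nt: "\<not> t dvd sg i" if "i < k + 5" for i using that by auto
  have I': "invariant_rel i \<and> (i < k \<longrightarrow> sum_rel i)" if "i \<le> k" for i
    using that
  proof (induction i)
    case 0
    show ?case using invariant_rel_0 sum_rel_step[OF S, of 0] nt[of 0] by auto
  next
    case (Suc i)
    have "invariant_rel (Suc i)" using Suc S[of i] by (intro invariant_rel_step) auto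
    moreover have "sg (Suc i) \<noteq> 0" using nt[of "Suc i"] Suc.prems by (intro ndvd_neq0) auto
    ultimately show ?case using sum_rel_step[OF S, of "Suc i"] by blast
  qed
  have E: "sum_rel i" if "i < k" for i using I'[of i] that by simp
  from Suc have c1: "coprime (sg (i + 1)) (sg i)" if "i \<ge> 1" "i < k + 4" for i using that by auto
  from Suc have c2: "coprime (sg (i + 2)) (sg i)" if "i \<ge> 1" "i < k + 3" for i using that by auto
  define N where "N = - \<beta> * t^2 * sg (k + 4) * sg (k + 1) - J * sg (k + 3) * sg (k + 2)"
  have sgk0: "sg k \<noteq> 0" using nt[of k] by auto
  have "sg k dvd N"
  proof -
    have "k = 0 \<or> k = 1 \<or> k = 2 \<or> k = 3 \<or> k = (k - 4) + 4" by auto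
    then consider "k = 0" | "k = 1" | "k = 2" | "k = 3" | j where "k = j + 4"
      by blast
    thus ?thesis
    proof cases
      case 1
      \<comment> \<open>Modulo \<open>V\<close>, \<open>J\<close> is
        \<open>- \<beta> * t^2 * U\<close>, which cancels the first summand of
        \<open>N\<close>.\<close>
      have "N = V * (- U * (U + V - \<alpha> * t) + \<beta> * t^2)"
        using sg_init unfolding N_def 1 J_def by (simp add: algebra_simps)
      thus ?thesis using 1 by simp
    next
      case 5
      have e: "k + 1 = j + 5" "k + 2 = j + 6" "k + 3 = j + 7" "k + 4 = j + 8"
        using 5 by auto
      have idx: "j + 3 + 5 = j + 8" "j + 3 + 4 = j + 7" "j + 3 + 1 = j + 4" "j + 3 + 3 = j + 6" "j + 3 + 2 = j + 5"
        "j + 2 + 5 = j + 7" "j + 2 + 4 = j + 6" "j + 2 + 1 = j + 3" "j + 2 + 3 = j + 5" "j + 2 + 2 = j + 4"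
        "j + 1 + 5 = j + 6" "j + 1 + 4 = j + 5" "j + 1 + 1 = j + 2" "j + 1 + 3 = j + 4" "j + 1 + 2 = j + 3"
        by auto
      have idx': "j + 3 + 1 = j + 4" "j + 2 + 2 = j + 4" by auto
      have "sg (j + 4) dvd sg (j + 3) * sg (j + 2)^2 * (- (\<beta> * t^2) * sg (j + 8) * sg (j + 5) - J * sg (j + 7) * sg (j + 6))"
      proof (rule somos5_divisibility)
        show "sg (j + 8) * sg (j + 3) = - (\<beta> * t^2) * sg (j + 7) * sg (j + 4) - J * sg (j + 6) * sg (j + 5)"
          using S[of "j + 3"] 5 unfolding somos_rel_def idx by simp
        show "sg (j + 7) * sg (j + 2) = - (\<beta> * t^2) * sg (j + 6) * sg (j + 3) - J * sg (j + 5) * sg (j + 4)"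
          using S[of "j + 2"] 5 unfolding somos_rel_def idx by simp
        show "sg (j + 6) * sg (j + 3)^2 * sg (j + 2) = - (sg (j + 5)^2 * sg (j + 2)^2) - sg (j + 4) *
           (sg (j + 5) * sg (j + 4) * sg (j + 1) - \<alpha> * t * sg (j + 5) * sg (j + 3) * sg (j + 2)
             - \<beta> * t^2 * sg (j + 4) * sg (j + 3)^2)"
          using E[of "j + 1"] 5 unfolding sum_rel_def idx by (simp add: algebra_simps power2_eq_square)
      qed
      hence "sg (j + 4) dvd sg (j + 3) * sg (j + 2)^2 * N"
        unfolding N_def e by simp
      moreover have "coprime (sg (j + 4)) (sg (j + 3) * sg (j + 2)^2)"
        using c1[of "j + 3"] c2[of "j + 2"] 5 unfolding idx' by simp
      ultimately show ?thesis using 5 by (simp add: coprime_dvd_mult_right_iff)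
    qed (use sg_init in auto)
  qed
  hence Sk: "somos_rel k"
    unfolding somos_rel_def sg_step N_def by simp
  have Ek: "sum_rel k" using sum_rel_step[OF Sk I sgk0] .
  have idx: "k + 3 + 1 = k + 4" "k + 2 + 2 = k + 4" "k + 1 + 2 = k + 3" by auto
  have ntk: "\<not> t dvd sg (k + 5)"
  proof
    assume a: "t dvd sg (k + 5)"
    \<comment> \<open>Modulo \<open>t\<close> only the \<open>J\<close> term of the recurrence
      survives.\<close>
    have "J * sg (k + 3) * sg (k + 2) = t * (- \<beta> * t * sg (k + 4) * sg (k + 1)) - sg (k + 5) * sg k"
      using Sk unfolding somos_rel_def by (simp add: algebra_simps power2_eq_square)
    moreover have "t dvd \<dots>" using a by (intro dvd_diff) auto
    ultimately have "t dvd J * sg (k + 3) * sg (k + 2)" by simp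
    thus False using prime_t t_ndvd_J nt[of "k + 3"] nt[of "k + 2"] by (simp add: prime_elem_dvd_mult_iff)
  qed
  have co1: "coprime (sg (k + 5)) (sg (k + 4))"
  proof (rule coprimeI_primes)
    fix p assume p: "prime_elem p" "p dvd sg (k + 5)" "p dvd sg (k + 4)"
    \<comment> \<open>This isolates the only term of \<open>sum_rel k\<close> that contains neither
      \<open>sg (k + 5)\<close> nor \<open>sg (k + 4)\<close>. For \<open>co2\<close> the
      corresponding term is \<open>sg (k + 4)^2 * sg (k + 1)^2\<close>.\<close>
    have "\<beta> * t^2 * sg (k + 3)^2 * sg (k + 2)^2 = sg (k + 5) * (sg (k + 2)^2 * sg (k + 1))
       + sg (k + 4) * (sg (k + 4) * sg (k + 1)^2 + sg (k + 3)^2 * sg k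
     - \<alpha> * t * sg (k + 3) * sg (k + 2) * sg (k + 1))"
      using Ek unfolding sum_rel_def by (simp add: algebra_simps power2_eq_square)
    hence "p dvd \<beta> * t^2 * sg (k + 3)^2 * sg (k + 2)^2" using p by simp
    moreover have "\<not> p dvd \<beta>" using p prime_ndvd_\<beta> by blast
    moreover have "\<not> p dvd t" using p ntk prime_common by blast
    moreover have "\<not> p dvd sg (k + 3)" using c1[of "k + 3", unfolded idx] p
      by (auto dest: coprime_common_divisor)
    moreover have "\<not> p dvd sg (k + 2)" using c2[of "k + 2", unfolded idx] p
      by (auto dest: coprime_common_divisor)
    ultimately show False using p by (simp add: prime_elem_dvd_mult_iff prime_elem_dvd_power_iff)
  qed (use ntk in auto)
  have co2: "coprime (sg (k + 5)) (sg (k + 3))"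
  proof (rule coprimeI_primes)
    fix p assume p: "prime_elem p" "p dvd sg (k + 5)" "p dvd sg (k + 3)"
    have "sg (k + 4)^2 * sg (k + 1)^2 = sg (k + 3) * (- (sg (k + 4) * sg (k + 3) * sg k)
     + \<alpha> * t * sg (k + 4) * sg (k + 2) * sg (k + 1)
     + \<beta> * t^2 * sg (k + 3) * sg (k + 2)^2) - sg (k + 5) * (sg (k + 2)^2 * sg (k + 1))"
      using Ek unfolding sum_rel_def by (simp add: algebra_simps power2_eq_square)
    hence "p dvd sg (k + 4)^2 * sg (k + 1)^2" using p by simp
    moreover have "\<not> p dvd sg (k + 4)" using c1[of "k + 3", unfolded idx] p
      by (auto dest: coprime_common_divisor)
    moreover have "\<not> p dvd sg (k + 1)" using c2[of "k + 1", unfolded idx] p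
      by (auto dest: coprime_common_divisor)
    ultimately show False using p by (simp add: prime_elem_dvd_mult_iff prime_elem_dvd_power_iff)
  qed (use ntk in auto)
  show ?case
  proof (intro conjI allI impI)
    show "invariant_rel (Suc k)" using invariant_rel_step[OF Sk Ek] .
  next
    fix i assume "i < Suc k" thus "somos_rel i" using S Sk by (cases "i = k") auto
  next
    fix i assume "i < Suc k + 5" thus "\<not> t dvd sg i" using nt ntk by (cases "i = k + 5") auto
  next
    fix i assume "i \<ge> 1" "i < Suc k + 4" hence "i = k + 4 \<or> i < k + 4" by auto
    moreover have "k + 4 + 1 = k + 5" by simp
    ultimately show "coprime (sg (i + 1)) (sg i)"
      using c1 co1 \<open>i \<ge> 1\<close> by metis
  next
    fix i assume "i \<ge> 1" "i < Suc k + 3" hence "i = k + 3 \<or> i < k + 3" by auto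
    moreover have "k + 3 + 2 = k + 5" by simp
    ultimately show "coprime (sg (i + 2)) (sg i)"
      using c2 co2 \<open>i \<ge> 1\<close> by metis
  qed
qed

lemma somos_rel: "somos_rel k" and t_ndvd_sg: "\<not> t dvd sg k" and invariant_rel: "invariant_rel k"
  using sg_all[of "Suc k"] sg_all[of k] by auto

lemma sg_neq0: "sg k \<noteq> 0"
  using t_ndvd_sg[of k] by auto

lemma sum_rel: "sum_rel k"
  using sum_rel_step[OF somos_rel invariant_rel sg_neq0] .

end

section \<open>The residue field of a prime element\<close>

text \<open>For prime \<open>p\<close> this is the localisation at \<open>p\<close> inside the
  fraction field. The residue field is not formed as a type: congruence modulo
  \<open>max_ideal p\<close> stands in for equality in it.\<close>

definition local_ring :: "'a::idom \<Rightarrow> 'a fract set" where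
  "local_ring p = {to_fract a / to_fract b | a b. \<not> p dvd b}"

definition max_ideal :: "'a::idom \<Rightarrow> 'a fract set" where
  "max_ideal p = {to_fract a / to_fract b | a b. p dvd a \<and> \<not> p dvd b}"

lemma max_ideal_local_ring: "x \<in> max_ideal p \<Longrightarrow> x \<in> local_ring p"
  unfolding max_ideal_def local_ring_def by auto

lemma local_ring_to_fract: "prime_elem p \<Longrightarrow> to_fract a \<in> local_ring p"
  unfolding local_ring_def using prime_elem_not_unit[of p] by (intro CollectI exI[of _ a] exI[of _ 1]) simp

lemma max_ideal_to_fract: "prime_elem p \<Longrightarrow> p dvd a \<Longrightarrow> to_fract a \<in> max_ideal p"
  unfolding max_ideal_def using prime_elem_not_unit[of p] by (intro CollectI exI[of _ a] exI[of _ 1]) simp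

lemma max_ideal_quot_iff:
  assumes "prime_elem p" "\<not> p dvd b"
  shows "to_fract a / to_fract b \<in> max_ideal p \<longleftrightarrow> p dvd a"
proof
  assume "to_fract a / to_fract b \<in> max_ideal p"
  then obtain a' b' where *: "to_fract a / to_fract b = to_fract a' / to_fract b'" "p dvd a'" "\<not> p dvd b'"
    unfolding max_ideal_def by auto
  have "b \<noteq> 0" "b' \<noteq> 0" using assms * by auto
  hence "to_fract (a * b') = to_fract (a' * b)" using *(1) by (simp add: field_simps)
  hence "a * b' = a' * b" by (simp del: to_fract_mult)
  hence "p dvd a * b'" using * by simp
  thus "p dvd a" using * assms(1) by (simp add: prime_elem_dvd_mult_iff)
qed (use assms in \<open>auto simp: max_ideal_def\<close>)

lemma local_ring_add: assumes "prime_elem p" "x \<in> local_ring p" "y \<in> local_ring p" shows "x + y \<in> local_ring p"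
proof -
  obtain a b c d where *: "x = to_fract a / to_fract b" "\<not> p dvd b" "y = to_fract c / to_fract d" "\<not> p dvd d"
    using assms unfolding local_ring_def by auto
  have nz: "b \<noteq> 0" "d \<noteq> 0" using * by auto
  have "x + y = to_fract (a * d + c * b) / to_fract (b * d)" using * nz by (simp add: field_simps)
  moreover have "\<not> p dvd b * d" using * assms by (simp add: prime_elem_dvd_mult_iff)
  ultimately show ?thesis unfolding local_ring_def by blast
qed

lemma local_ring_mult: assumes "prime_elem p" "x \<in> local_ring p" "y \<in> local_ring p" shows "x * y \<in> local_ring p"
proof -
  obtain a b c d where *: "x = to_fract a / to_fract b" "\<not> p dvd b" "y = to_fract c / to_fract d" "\<not> p dvd d"
    using assms unfolding local_ring_def by auto
  have "x * y = to_fract (a * c) / to_fract (b * d)" using * by simp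
  moreover have "\<not> p dvd b * d" using * assms by (simp add: prime_elem_dvd_mult_iff)
  ultimately show ?thesis unfolding local_ring_def by blast
qed

lemma local_ring_uminus: assumes "x \<in> local_ring p" shows "- x \<in> local_ring p"
proof -
  obtain a b where *: "x = to_fract a / to_fract b" "\<not> p dvd b"
    using assms unfolding local_ring_def by auto
  have "- x = to_fract (- a) / to_fract b" using * by simp
  thus ?thesis using * unfolding local_ring_def by blast
qed

lemma local_ring_diff: "prime_elem p \<Longrightarrow> x \<in> local_ring p \<Longrightarrow> y \<in> local_ring p \<Longrightarrow> x - y \<in> local_ring p"
  using local_ring_add[of p x "- y"] local_ring_uminus by auto

lemma max_ideal_0: "prime_elem p \<Longrightarrow> 0 \<in> max_ideal p"
  using max_ideal_to_fract[of p 0] by simp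

lemma max_ideal_add: assumes "prime_elem p" "x \<in> max_ideal p" "y \<in> max_ideal p" shows "x + y \<in> max_ideal p"
proof -
  obtain a b c d where *: "x = to_fract a / to_fract b" "p dvd a" "\<not> p dvd b"
      "y = to_fract c / to_fract d" "p dvd c" "\<not> p dvd d"
    using assms unfolding max_ideal_def by auto
  have nz: "b \<noteq> 0" "d \<noteq> 0" using * by auto
  have "x + y = to_fract (a * d + c * b) / to_fract (b * d)" using * nz by (simp add: field_simps)
  moreover have "\<not> p dvd b * d" using * assms by (simp add: prime_elem_dvd_mult_iff)
  moreover have "p dvd a * d + c * b" using * by simp
  ultimately show ?thesis unfolding max_ideal_def by blast
qed

lemma max_ideal_mult: assumes "prime_elem p" "x \<in> max_ideal p" "y \<in> local_ring p" shows "x * y \<in> max_ideal p" "y * x \<in> max_ideal p"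
proof -
  obtain a b c d where *: "x = to_fract a / to_fract b" "p dvd a" "\<not> p dvd b"
      "y = to_fract c / to_fract d" "\<not> p dvd d"
    using assms unfolding max_ideal_def local_ring_def by auto
  have "x * y = to_fract (a * c) / to_fract (b * d)" using * by simp
  moreover have "\<not> p dvd b * d" "p dvd a * c" using * assms by (simp_all add: prime_elem_dvd_mult_iff)
  ultimately show "x * y \<in> max_ideal p" unfolding max_ideal_def by blast
  thus "y * x \<in> max_ideal p" by (simp add: mult.commute)
qed

lemma max_ideal_uminus: assumes "x \<in> max_ideal p" shows "- x \<in> max_ideal p"
proof -
  obtain a b where *: "x = to_fract a / to_fract b" "p dvd a" "\<not> p dvd b"
    using assms unfolding max_ideal_def by auto
  have "- x = to_fract (- a) / to_fract b" "p dvd - a" using * by simp_all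
  thus ?thesis using * unfolding max_ideal_def by blast
qed

lemma max_ideal_diff: "prime_elem p \<Longrightarrow> x \<in> max_ideal p \<Longrightarrow> y \<in> max_ideal p \<Longrightarrow> x - y \<in> max_ideal p"
  using max_ideal_add[of p x "- y"] max_ideal_uminus by auto

lemma local_ring_inverse: assumes "x \<in> local_ring p" "x \<notin> max_ideal p" shows "inverse x \<in> local_ring p"
proof -
  obtain a b where *: "x = to_fract a / to_fract b" "\<not> p dvd b"
    using assms unfolding local_ring_def by auto
  hence "\<not> p dvd a" using assms unfolding max_ideal_def by blast
  moreover have "inverse x = to_fract b / to_fract a" using * by simp
  ultimately show ?thesis unfolding local_ring_def by blast
qed

lemma max_ideal_prime: assumes "prime_elem p" "x \<in> local_ring p" "y \<in> local_ring p" "x * y \<in> max_ideal p" shows "x \<in> max_ideal p \<or> y \<in> max_ideal p"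
proof (rule ccontr)
  assume a: "\<not> (x \<in> max_ideal p \<or> y \<in> max_ideal p)"
  have "x * y * inverse x \<in> max_ideal p" using assms a local_ring_inverse max_ideal_mult by blast
  moreover have "x \<noteq> 0" using a max_ideal_0 assms by auto
  moreover from this have "x * y * inverse x = y" by simp
  ultimately show False using a by simp
qed

definition residue_eq :: "'a::idom \<Rightarrow> 'a fract \<Rightarrow> 'a fract \<Rightarrow> bool" where
  "residue_eq p x y \<longleftrightarrow> x - y \<in> max_ideal p"

lemma residue_eq_refl: "prime_elem p \<Longrightarrow> residue_eq p x x"
  unfolding residue_eq_def by (simp add: max_ideal_0)

lemma residue_eq_sym: "residue_eq p x y \<Longrightarrow> residue_eq p y x"
  unfolding residue_eq_def using max_ideal_uminus[of "x - y" p] by simp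

lemma residue_eq_trans: "prime_elem p \<Longrightarrow> residue_eq p x y \<Longrightarrow> residue_eq p y z \<Longrightarrow> residue_eq p x z"
  unfolding residue_eq_def using max_ideal_add[of p "x - y" "y - z"] by simp

lemma residue_eq_add: "prime_elem p \<Longrightarrow> residue_eq p x y \<Longrightarrow> residue_eq p x' y' \<Longrightarrow> residue_eq p (x + x') (y + y')"
  unfolding residue_eq_def using max_ideal_add[of p "x - y" "x' - y'"] by (simp add: algebra_simps)

lemma residue_eq_diff: "prime_elem p \<Longrightarrow> residue_eq p x y \<Longrightarrow> residue_eq p x' y' \<Longrightarrow> residue_eq p (x - x') (y - y')"
  unfolding residue_eq_def using max_ideal_diff[of p "x - y" "x' - y'"] by (simp add: algebra_simps)

lemma residue_eq_mult:
  assumes "prime_elem p" "residue_eq p x y" "residue_eq p x' y'" "x \<in> local_ring p" "y' \<in> local_ring p"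
  shows "residue_eq p (x * x') (y * y')"
proof -
  have "x * x' - y * y' = x * (x' - y') + (x - y) * y'" by (simp add: algebra_simps)
  thus ?thesis using assms max_ideal_mult max_ideal_add unfolding residue_eq_def by metis
qed

lemma residue_eq_max_ideal: "prime_elem p \<Longrightarrow> residue_eq p x y \<Longrightarrow> x \<in> max_ideal p \<longleftrightarrow> y \<in> max_ideal p"
  unfolding residue_eq_def using max_ideal_add[of p "x - y" y] max_ideal_diff[of p x "x - y"] by auto

lemma residue_eq_local_ring: "prime_elem p \<Longrightarrow> residue_eq p x y \<Longrightarrow> x \<in> local_ring p \<longleftrightarrow> y \<in> local_ring p"
  unfolding residue_eq_def using local_ring_add[of p "x - y" y] local_ring_diff[of p x "x - y"] max_ideal_local_ring by auto

lemma residue_eq_inverse: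
  assumes "prime_elem p" "residue_eq p x y" "x \<in> local_ring p" "x \<notin> max_ideal p"
  shows "residue_eq p (inverse x) (inverse y)"
proof -
  have y: "y \<in> local_ring p" "y \<notin> max_ideal p" using assms residue_eq_local_ring residue_eq_max_ideal by blast+
  have nz: "x \<noteq> 0" "y \<noteq> 0" using y assms max_ideal_0 by auto
  have "inverse x - inverse y = (y - x) * (inverse x * inverse y)" using nz by (simp add: field_simps)
  moreover have "y - x \<in> max_ideal p" using assms(2) residue_eq_sym unfolding residue_eq_def by blast
  ultimately show ?thesis unfolding residue_eq_def
    using max_ideal_mult local_ring_mult local_ring_inverse assms y by metis
qed

section \<open>Generic orbits of the recurrence\<close>

text \<open>
  \<open>orbit_num a b j / orbit_den a b j\<close> is an unreduced fraction in \<open>s\<close> for the \<open>j\<close>-th term of the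
  orbit starting with \<open>0, s\<close>.
\<close>

fun orbit_num orbit_den :: "complex \<Rightarrow> complex \<Rightarrow> nat \<Rightarrow> complex poly" where
  "orbit_num a b 0 = 0"
| "orbit_num a b (Suc 0) = [:0, 1:]"
| "orbit_num a b (Suc (Suc j)) = - (orbit_num a b (Suc j)^2 * orbit_den a b j) - orbit_num a b j * orbit_num a b (Suc j) * orbit_den a b (Suc j)
     + smult a (orbit_num a b (Suc j) * orbit_den a b (Suc j) * orbit_den a b j) + smult b (orbit_den a b (Suc j)^2 * orbit_den a b j)"
| "orbit_den a b 0 = 1"
| "orbit_den a b (Suc 0) = 1"
| "orbit_den a b (Suc (Suc j)) = orbit_num a b (Suc j) * orbit_den a b (Suc j) * orbit_den a b j"

fun orbit :: "complex \<Rightarrow> complex \<Rightarrow> nat \<Rightarrow> complex \<Rightarrow> complex" where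
  "orbit a b 0 s = 0"
| "orbit a b (Suc 0) s = s"
| "orbit a b (Suc (Suc j)) s = a + b / orbit a b (Suc j) s - orbit a b (Suc j) s - orbit a b j s"

text \<open>Subtracting two consecutive instances of the recurrence removes \<open>a\<close> and
  gives g(j+3) = g(j) + b/g(j+2) - b/g(j+1). To leading order the pattern thus repeats with period
  three: one term of order 1/s, then two opposite ones of order s, with coefficients that the
  induction tracks.\<close>

lemma orbit_asymp:
  assumes "b \<noteq> 0"
  shows "((\<lambda>s. orbit a b (3 * k) s * s) \<longlongrightarrow> - of_nat (k * (k + 1)) * b) at_infinity \<and>
    ((\<lambda>s. orbit a b (3 * k + 1) s / s) \<longlongrightarrow> 1 / of_nat (k + 1)) at_infinity \<and>
    ((\<lambda>s. orbit a b (3 * k + 2) s / s) \<longlongrightarrow> - 1 / of_nat (k + 1)) at_infinity"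
proof (induction k)
  case 0
  have inv: "((\<lambda>s::complex. inverse s) \<longlongrightarrow> 0) at_infinity"
    by (rule tendsto_inverse_0)
  have nz: "eventually (\<lambda>s::complex. s \<noteq> 0) at_infinity"
    by (rule eventually_not_equal_at_infinity)
  have "((\<lambda>s. a * inverse s + b * inverse s * inverse s - 1) \<longlongrightarrow> a * 0 + b * 0 * 0 - 1) at_infinity"
    by (intro tendsto_intros inv)
  moreover have "eventually (\<lambda>s. a * inverse s + b * inverse s * inverse s - 1 = orbit a b 2 s / s) at_infinity"
    using nz
  proof eventually_elim
    case (elim s)
    have "orbit a b 2 s = a + b / s - s" by (simp add: eval_nat_numeral)
    thus ?case using elim by (simp add: divide_inverse ring_distribs)
  qed
  ultimately have "((\<lambda>s. orbit a b 2 s / s) \<longlongrightarrow> a * 0 + b * 0 * 0 - 1) at_infinity"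
    by (rule Lim_transform_eventually)
  moreover have "((\<lambda>s. s / s) \<longlongrightarrow> (1::complex)) at_infinity"
    by (rule tendsto_eventually) (use nz in eventually_elim, simp)
  ultimately show ?case by (simp add: numeral_2_eq_2 del: orbit.simps(3))
next
  case (Suc k)
  have inv: "((\<lambda>s::complex. inverse s) \<longlongrightarrow> 0) at_infinity"
    by (rule tendsto_inverse_0)
  have nz: "eventually (\<lambda>s::complex. s \<noteq> 0) at_infinity"
    by (rule eventually_not_equal_at_infinity)
  let ?g = "orbit a b"
  define K :: complex where "K = of_nat (k + 1)"
  have "K + 1 = of_nat (Suc (Suc k))" by (simp add: K_def)
  hence K0: "K \<noteq> 0" "K + 1 \<noteq> 0"
    using of_nat_neq_0[where 'a = complex] K_def by (metis Suc_eq_plus1)+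
  have kK: "of_nat (k * (k + 1)) = (K - 1) * K"
    by (simp add: K_def algebra_simps)
  from Suc[unfolded kK, folded K_def] have L0: "((\<lambda>s. ?g (3 * k) s * s) \<longlongrightarrow> - ((K - 1) * K) * b) at_infinity"
    and L1: "((\<lambda>s. ?g (3 * k + 1) s / s) \<longlongrightarrow> 1 / K) at_infinity"
    and L2: "((\<lambda>s. ?g (3 * k + 2) s / s) \<longlongrightarrow> - 1 / K) at_infinity" by blast+
  \<comment> \<open>For \<open>x = 0\<close> both sides are divisions by zero, hence 0, so zeros of
    the orbit need no separate treatment in the limits.\<close>
  have cancel: "s \<noteq> 0 \<Longrightarrow> b * inverse s * inverse s / (x / s) = b / (x * s)" for s x :: complex
    by (cases "x = 0") (simp_all add: field_simps)
  have e1: "?g (3 * k + 3) s = ?g (3 * k) s + b / ?g (3 * k + 2) s - b / ?g (3 * k + 1) s" for s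
    by (simp add: eval_nat_numeral)
  have e2: "?g (3 * k + 4) s = ?g (3 * k + 1) s + b / ?g (3 * k + 3) s - b / ?g (3 * k + 2) s" for s
    by (simp add: eval_nat_numeral)
  have e3: "?g (3 * k + 5) s = ?g (3 * k + 2) s + b / ?g (3 * k + 4) s - b / ?g (3 * k + 3) s" for s
    by (simp add: eval_nat_numeral)
  have "((\<lambda>s. ?g (3 * k) s * s + b / (?g (3 * k + 2) s / s) - b / (?g (3 * k + 1) s / s)) \<longlongrightarrow>
      - ((K - 1) * K) * b + b / (- 1 / K) - b / (1 / K)) at_infinity"
    by (intro tendsto_intros L0 L1 L2) (use K0 in simp_all)
  also have "- ((K - 1) * K) * b + b / (- 1 / K) - b / (1 / K) = - (K * (K + 1)) * b"
    by (simp add: algebra_simps)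
  finally have M0: "((\<lambda>s. ?g (3 * k + 3) s * s) \<longlongrightarrow> - (K * (K + 1)) * b) at_infinity"
    by (rule Lim_transform_eventually) (use nz in eventually_elim, unfold e1, simp add: ring_distribs del: orbit.simps)
  have "((\<lambda>s. ?g (3 * k + 1) s / s + b / (?g (3 * k + 3) s * s) - b * inverse s * inverse s / (?g (3 * k + 2) s / s)) \<longlongrightarrow>
      1 / K + b / (- (K * (K + 1)) * b) - b * 0 * 0 / (- 1 / K)) at_infinity"
    by (intro tendsto_intros M0 L1 L2 inv) (use K0 assms in simp_all)
  also have "1 / K + b / (- (K * (K + 1)) * b) - b * 0 * 0 / (- 1 / K) = 1 / (K + 1)"
    using K0 assms by (simp add: divide_simps; simp add: algebra_simps)
  finally have M1: "((\<lambda>s. ?g (3 * k + 4) s / s) \<longlongrightarrow> 1 / (K + 1)) at_infinity"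
    by (rule Lim_transform_eventually) (use nz in eventually_elim, unfold e2, simp only: cancel simp_thms add_divide_distrib diff_divide_distrib divide_divide_eq_left)
  have "((\<lambda>s. ?g (3 * k + 2) s / s + b * inverse s * inverse s / (?g (3 * k + 4) s / s) - b / (?g (3 * k + 3) s * s)) \<longlongrightarrow>
      - 1 / K + b * 0 * 0 / (1 / (K + 1)) - b / (- (K * (K + 1)) * b)) at_infinity"
    by (intro tendsto_intros M0 M1 L2 inv) (use K0 assms in simp_all)
  also have "- 1 / K + b * 0 * 0 / (1 / (K + 1)) - b / (- (K * (K + 1)) * b) = - 1 / (K + 1)"
    using K0 assms by (simp add: divide_simps; simp add: algebra_simps)
  finally have M2: "((\<lambda>s. ?g (3 * k + 5) s / s) \<longlongrightarrow> - 1 / (K + 1)) at_infinity"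
    by (rule Lim_transform_eventually) (use nz in eventually_elim, unfold e3, simp only: cancel simp_thms add_divide_distrib diff_divide_distrib divide_divide_eq_left)
  have "3 * Suc k = 3 * k + 3" "3 * Suc k + 1 = 3 * k + 4" "3 * Suc k + 2 = 3 * k + 5" by auto
  moreover have "(of_nat (Suc k * (Suc k + 1)) :: complex) = K * (K + 1)" "(of_nat (Suc k + 1) :: complex) = K + 1"
    by (simp_all add: K_def algebra_simps)
  ultimately show ?case using M0 M1 M2 by (simp only:)
qed

lemma orbit_nonzero:
  assumes "b \<noteq> 0" "j > 0"
  shows "eventually (\<lambda>s. orbit a b j s \<noteq> 0) at_infinity"
proof -
  define k where "k = j div 3"
  have "j = 3 * k \<or> j = 3 * k + 1 \<or> j = 3 * k + 2" unfolding k_def by presburger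
  moreover have "eventually (\<lambda>s. orbit a b (3 * k) s * s \<noteq> 0) at_infinity" if "j = 3 * k"
  proof (rule tendsto_imp_eventually_ne)
    show "((\<lambda>s. orbit a b (3 * k) s * s) \<longlongrightarrow> - of_nat (k * (k + 1)) * b) at_infinity"
      using orbit_asymp[OF assms(1), of a k] by blast
    \<comment> \<open>\<open>j > 0\<close> forces \<open>k > 0\<close>; for \<open>k = 0\<close> the
      limit would be 0.\<close>
    have "(of_nat (k * (k + 1)) :: complex) \<noteq> 0" using assms that by (subst of_nat_eq_0_iff) auto
    thus "- of_nat (k * (k + 1)) * b \<noteq> 0" using assms(1) by (metis mult_eq_0_iff neg_equal_0_iff_equal)
  qed
  moreover have "eventually (\<lambda>s. orbit a b (3 * k + 1) s / s \<noteq> 0) at_infinity"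
    using orbit_asymp[OF assms(1), of a k]
    by (intro tendsto_imp_eventually_ne[of _ "1 / of_nat (k + 1)"]) (simp_all del: of_nat_add of_nat_Suc orbit.simps)
  moreover have "eventually (\<lambda>s. orbit a b (3 * k + 2) s / s \<noteq> 0) at_infinity"
    using orbit_asymp[OF assms(1), of a k]
    by (intro tendsto_imp_eventually_ne[of _ "- 1 / of_nat (k + 1)"]) (simp_all del: of_nat_add of_nat_Suc orbit.simps)
  ultimately show ?thesis by (auto elim: eventually_mono)
qed

text \<open>At a sufficiently large \<open>s\<close> all orbit terms up to index
  \<open>Suc j\<close>, except the initial 0, are nonzero. There the fraction really has the orbit
  as its value, so neither polynomial can be zero.\<close>

lemma orbit_num_den_nonzero:
  assumes "b \<noteq> 0"
  shows "orbit_den a b j \<noteq> 0 \<and> (j > 0 \<longrightarrow> orbit_num a b j \<noteq> 0)"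
proof -
  have "eventually (\<lambda>s. \<forall>j\<in>{1..n}. orbit a b j s \<noteq> 0) at_infinity" for n
    by (rule eventually_ball_finite) (use orbit_nonzero[OF assms] in auto)
  then obtain B where B: "\<And>s. B \<le> norm s \<Longrightarrow> \<forall>i\<in>{1..Suc j}. orbit a b i s \<noteq> 0"
    unfolding eventually_at_infinity by blast
  define s where "s = complex_of_real \<bar>B\<bar>"
  have s: "\<And>i. i \<in> {1..Suc j} \<Longrightarrow> orbit a b i s \<noteq> 0"
    using B[of s] unfolding s_def by auto
  have "i \<le> j \<Longrightarrow> poly (orbit_den a b i) s \<noteq> 0 \<and> poly (orbit_num a b i) s = orbit a b i s * poly (orbit_den a b i) s
     \<and> poly (orbit_den a b (Suc i)) s \<noteq> 0 \<and> poly (orbit_num a b (Suc i)) s = orbit a b (Suc i) s * poly (orbit_den a b (Suc i)) s" for i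
  proof (induction i)
    case 0
    show ?case by simp
  next
    case (Suc i)
    define g0 g1 d0 d1 where "g0 = orbit a b i s" and "g1 = orbit a b (Suc i) s"
      and "d0 = poly (orbit_den a b i) s" and "d1 = poly (orbit_den a b (Suc i)) s"
    have g1: "g1 \<noteq> 0" using s[of "Suc i"] Suc.prems unfolding g1_def by auto
    have IH: "d0 \<noteq> 0" "poly (orbit_num a b i) s = g0 * d0" "d1 \<noteq> 0" "poly (orbit_num a b (Suc i)) s = g1 * d1"
      using Suc unfolding g0_def g1_def d0_def d1_def by simp_all
    have D: "poly (orbit_den a b (Suc (Suc i))) s = g1 * d1 * d1 * d0"
      by (simp add: IH flip: d0_def d1_def)
    have "poly (orbit_num a b (Suc (Suc i))) s = (a + b / g1 - g1 - g0) * (g1 * d1 * d1 * d0)"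
      using g1 by (simp add: IH power2_eq_square ring_distribs flip: d0_def d1_def)
    moreover have "orbit a b (Suc (Suc i)) s = a + b / g1 - g1 - g0"
      by (simp add: g0_def g1_def)
    ultimately show ?case using IH g1 D by (simp del: orbit_num.simps orbit_den.simps orbit.simps flip: g1_def d1_def)
  qed
  from this[of j] have "poly (orbit_den a b j) s \<noteq> 0" "poly (orbit_num a b j) s = orbit a b j s * poly (orbit_den a b j) s" by auto
  moreover have "orbit a b j s \<noteq> 0" if "j > 0" using s[of j] that by auto
  ultimately show ?thesis by auto
qed

section \<open>Pairwise coprimality of the Somos-5 sequence\<close>

text \<open>\<open>\<iota>\<close> embeds the constants. \<open>no_common_prime\<close> says that
  modulo a prime not dividing \<open>t\<close> the two initial values \<open>U / t\<close> and
  \<open>V / t\<close> are never both constant.\<close>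

locale somos5_complex =
  fixes U V t :: "'a::factorial_ring_gcd" and \<iota> :: "complex \<Rightarrow> 'a" and a b :: complex
  assumes \<iota>_add: "\<iota> (x + y) = \<iota> x + \<iota> y" and \<iota>_mult: "\<iota> (x * y) = \<iota> x * \<iota> y" and \<iota>_1: "\<iota> 1 = 1"
    and prime_t: "prime_elem t" and t_ndvd: "\<not> t dvd U * V * (U + V)" and b_neq0: "b \<noteq> 0"
    and no_common_prime: "prime_elem p \<Longrightarrow> p dvd U - \<iota> x * t \<Longrightarrow> p dvd V - \<iota> y * t \<Longrightarrow> False"
begin

sublocale somos5 U V t "\<iota> a" "\<iota> b"
proof
  have "\<iota> b * \<iota> (1 / b) = 1" using b_neq0 \<iota>_1 by (simp flip: \<iota>_mult)
  thus "is_unit (\<iota> b)" by (metis dvd_triv_left)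
qed (use prime_t t_ndvd in auto)

abbreviation C :: "complex \<Rightarrow> 'a fract" where "C x \<equiv> to_fract (\<iota> x)"

lemma \<iota>_0: "\<iota> 0 = 0"
  using \<iota>_add[of 0 0] by (metis add_0 add_cancel_right_right)

lemma C_hom: "C (x + y) = C x + C y" "C (x * y) = C x * C y" "C 0 = 0" "C 1 = 1"
  by (simp_all add: \<iota>_add \<iota>_mult \<iota>_0 \<iota>_1)

lemma C_uminus: "C (- x) = - C x"
  using C_hom(1)[of x "-x"] C_hom(3) by (simp add: eq_neg_iff_add_eq_0 add.commute)

lemma C_diff: "C (x - y) = C x - C y"
  using C_hom(1)[of x "-y"] C_uminus[of y] by simp

lemma C_neq0: "x \<noteq> 0 \<Longrightarrow> C x \<noteq> 0"
  using C_hom(2)[of x "1 / x"] C_hom(4) by auto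

lemma C_divide: "y \<noteq> 0 \<Longrightarrow> C (x / y) = C x / C y"
  using C_hom(2)[of "x / y" y] C_neq0[of y] by (simp add: field_simps)

section \<open>The solution of the recurrence and its conserved quantity\<close>

definition w :: "nat \<Rightarrow> 'a fract" where
  "w k = to_fract (sg (k + 3) * sg k) / to_fract (sg (k + 2) * sg (k + 1) * t)"

lemma w_neq0: "w k \<noteq> 0"
  unfolding w_def using sg_neq0 t_neq0 by simp

lemma w_rec: "w (k + 2) = C a + C b / w (k + 1) - w (k + 1) - w k"
proof -
  define s where "s i = to_fract (sg (k + i))" for i
  define T where "T = to_fract t"
  have nz: "s i \<noteq> 0" "T \<noteq> 0" for i unfolding s_def T_def using sg_neq0 t_neq0 by simp_all
  have i: "k + 2 + 3 = k + 5" "k + 2 + 2 = k + 4" "k + 2 + 1 = k + 3"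
     "k + 1 + 3 = k + 4" "k + 1 + 2 = k + 3" "k + 1 + 1 = k + 2" by auto
  have w: "w k = s 3 * s 0 / (s 2 * s 1 * T)" "w (k + 1) = s 4 * s 1 / (s 3 * s 2 * T)"
     "w (k + 2) = s 5 * s 2 / (s 4 * s 3 * T)"
    unfolding w_def i s_def T_def by simp_all
  have "s 5 * s 2 * s 2 * s 1 = - (s 4 * s 4 * s 1 * s 1) - s 4 * s 3 * s 3 * s 0
     + C a * T * s 4 * s 3 * s 2 * s 1 + C b * T * T * s 3 * s 3 * s 2 * s 2"
    using arg_cong[OF sum_rel[of k, unfolded sum_rel_def], of to_fract] unfolding s_def T_def
    by (simp add: power2_eq_square mult.assoc)
  hence "w (k + 2) + w (k + 1) + w k = C a + C b / w (k + 1)"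
    unfolding w using nz by (simp add: field_simps)
  thus ?thesis by (simp add: algebra_simps)
qed

definition I :: "nat \<Rightarrow> 'a fract" where
  "I k = w k * w (k + 1) * (w k + w (k + 1) - C a) - C b * (w k + w (k + 1))"

text \<open>\<open>I\<close> is symmetric in its two arguments and quadratic in each; for fixed
  \<open>w (k + 1)\<close> the recurrence exchanges the two roots \<open>w k\<close> and
  \<open>w (k + 2)\<close>.\<close>

lemma I_const: "I k = I 0"
proof (induction k)
  case (Suc k)
  have e: "Suc k = k + 1" "k + 1 + 1 = k + 2" by auto
  have "w (k + 2) * w (k + 1) = C a * w (k + 1) + C b - w (k + 1) * w (k + 1) - w k * w (k + 1)"
    unfolding w_rec using w_neq0[of "k + 1"] by (simp add: field_simps)
  hence "I (Suc k) = I k"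
    unfolding I_def e by algebra
  with Suc show ?case by simp
qed simp

section \<open>Transcendental elements of the residue field\<close>

definition ev :: "'a fract \<Rightarrow> complex poly \<Rightarrow> 'a fract" where
  "ev s F = poly (map_poly C F) s"

lemma ev_simps:
  "ev s 0 = 0" "ev s 1 = 1" "ev s (pCons c F) = C c + s * ev s F" "ev s (F + G) = ev s F + ev s G"
  "ev s (smult c F) = C c * ev s F" "ev s (F * G) = ev s F * ev s G" "ev s (- F) = - ev s F" "ev s (F - G) = ev s F - ev s G"
proof -
  show 0: "ev s 0 = 0" by (simp add: ev_def)
  show "ev s 1 = 1" by (simp add: ev_def C_hom map_poly_1')
  show p: "ev s (pCons c F) = C c + s * ev s F" for c F by (simp add: ev_def map_poly_pCons C_hom)
  show add: "ev s (F + G) = ev s F + ev s G" for F G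
  proof -
    have "map_poly C (F + G) = map_poly C F + map_poly C G"
      by (intro poly_eqI) (simp add: coeff_map_poly C_hom)
    thus ?thesis by (simp add: ev_def)
  qed
  show sm: "ev s (smult c F) = C c * ev s F" for c F
    unfolding ev_def using map_poly_smult[of C c F] C_hom by simp
  show "ev s (F * G) = ev s F * ev s G"
  proof (induction F)
    case (pCons c F)
    thus ?case by (simp add: add sm p C_hom algebra_simps)
  qed (simp add: 0)
  show um: "ev s (- F) = - ev s F" for F
    using sm[of "-1" F] C_uminus[of 1] C_hom(4) by simp
  show "ev s (F - G) = ev s F - ev s G"
    using add[of F "-G"] um[of G] by simp
qed

lemma C_unit: assumes "prime_elem p" "x \<noteq> 0" shows "C x \<notin> max_ideal p"
proof
  assume "C x \<in> max_ideal p"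
  hence "p dvd \<iota> x" using max_ideal_quot_iff[OF assms(1), of 1 "\<iota> x"] assms(1) prime_elem_not_unit[of p] by simp
  moreover have "\<iota> x * \<iota> (1 / x) = 1" using assms \<iota>_1 by (simp flip: \<iota>_mult)
  ultimately have "p dvd 1" by (metis dvd_mult2)
  thus False using assms prime_elem_not_unit by blast
qed

lemma ev_local_ring:
  assumes "prime_elem p" "s \<in> local_ring p"
  shows "ev s F \<in> local_ring p"
proof (induction F)
  case 0
  show ?case using max_ideal_0[OF assms(1)] max_ideal_local_ring by (simp add: ev_simps)
next
  case (pCons c F)
  thus ?case using assms by (simp add: ev_simps local_ring_add local_ring_mult local_ring_to_fract)
qed

text \<open>Over the algebraically closed constants \<open>F\<close> splits into linear factors, and
  each factor is nonzero modulo \<open>p\<close> because \<open>s\<close> is congruent to no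
  constant.\<close>

lemma ev_unit:
  assumes "prime_elem p" "s \<in> local_ring p" and trans: "\<And>\<kappa>. \<not> residue_eq p s (C \<kappa>)" and "F \<noteq> 0"
  shows "ev s F \<notin> max_ideal p"
  using \<open>F \<noteq> 0\<close>
proof (induction "degree F" arbitrary: F rule: less_induct)
  case less
  show ?case
  proof (cases "degree F = 0")
    case True
    then obtain c where "F = [:c:]" by (auto elim: degree_eq_zeroE)
    with less.prems show ?thesis using C_unit[OF assms(1), of c] by (simp add: ev_simps)
  next
    case False
    then obtain z where "poly F z = 0"
      using fundamental_theorem_of_algebra[of F] constant_degree[of F] by auto
    then obtain G where G: "F = [:- z, 1:] * G" by (auto simp: poly_eq_0_iff_dvd elim: dvdE)
    have "G \<noteq> 0" using G less.prems by auto
    moreover from this have "degree G < degree F"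
      unfolding G by (subst degree_mult_eq) auto
    ultimately have "ev s G \<notin> max_ideal p" using less.hyps by blast
    moreover have "ev s [:- z, 1:] \<notin> max_ideal p"
      using trans[of z] C_uminus[of z] unfolding residue_eq_def by (simp add: ev_simps C_hom)
    ultimately show ?thesis
      unfolding G ev_simps(6) using max_ideal_prime[OF assms(1)] ev_local_ring[OF assms(1,2)] by blast
  qed
qed

lemma w_local_ring:
  assumes "prime_elem p" "\<not> p dvd t" "\<not> p dvd sg (k + 1)" "\<not> p dvd sg (k + 2)"
  shows "w k \<in> local_ring p" "w k \<in> max_ideal p \<longleftrightarrow> p dvd sg (k + 3) \<or> p dvd sg k"
proof -
  have n: "\<not> p dvd sg (k + 2) * sg (k + 1) * t"
    using assms by (simp add: prime_elem_dvd_mult_iff)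
  thus "w k \<in> local_ring p" unfolding w_def local_ring_def by blast
  show "w k \<in> max_ideal p \<longleftrightarrow> p dvd sg (k + 3) \<or> p dvd sg k"
    unfolding w_def max_ideal_quot_iff[OF assms(1) n] by (rule prime_elem_dvd_mult_iff[OF assms(1)])
qed

section \<open>A prime at its first occurrence in the sequence\<close>

context
  fixes p :: 'a and k :: nat
  assumes p: "prime_elem p" and p_dvd: "p dvd sg (k + 4)"
    and p_ndvd: "\<And>i. 1 \<le> i \<Longrightarrow> i < k + 4 \<Longrightarrow> \<not> p dvd sg i"
begin

lemma p_ndvd_t: "\<not> p dvd t"
  using prime_common[OF p _ p_dvd] t_ndvd_sg by blast

text \<open>In each case the relation used has a single term free of the entries assumed divisible.
  With these three entries prime to \<open>p\<close>, the pattern zero, pole, pole, zero of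
  \<open>w (k + 1)\<close> to \<open>w (k + 4)\<close> is complete and \<open>w (k + 5)\<close> is
  finite modulo \<open>p\<close>.\<close>

lemma p_ndvd_next: "\<not> p dvd sg (k + 5)" "\<not> p dvd sg (k + 6)" "\<not> p dvd sg (k + 7)"
proof -
  note iff = prime_elem_dvd_mult_iff[OF p] prime_elem_dvd_power_iff[OF p]
  note nd = p_ndvd_t prime_ndvd_\<beta>[OF p] p_ndvd[of "k + 1"] p_ndvd[of "k + 2"] p_ndvd[of "k + 3"]
  show 1: "\<not> p dvd sg (k + 5)"
  proof
    assume d: "p dvd sg (k + 5)"
    have "\<iota> b * t^2 * sg (k + 3)^2 * sg (k + 2)^2 = sg (k + 5) * (sg (k + 2)^2 * sg (k + 1))
       + sg (k + 4) * (sg (k + 4) * sg (k + 1)^2 + sg (k + 3)^2 * sg k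
     - \<iota> a * t * sg (k + 3) * sg (k + 2) * sg (k + 1))"
      using sum_rel[of k] unfolding sum_rel_def by (simp add: algebra_simps power2_eq_square)
    moreover have "p dvd \<dots>" using d p_dvd by (intro dvd_add) auto
    ultimately have "p dvd \<iota> b * t^2 * sg (k + 3)^2 * sg (k + 2)^2" by simp
    thus False using nd by (simp add: iff)
  qed
  show 2: "\<not> p dvd sg (k + 6)"
  proof
    assume d: "p dvd sg (k + 6)"
    have i: "k + 1 + 5 = k + 6" "k + 1 + 4 = k + 5" "k + 1 + 3 = k + 4" "k + 1 + 2 = k + 3" "k + 1 + 1 = k + 2" by auto
    have "\<iota> b * t^2 * sg (k + 5) * sg (k + 2) = - (sg (k + 6) * sg (k + 1)) - sg (k + 4) * (J * sg (k + 3))"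
      unfolding somos_rel[of "k + 1", unfolded somos_rel_def i] by (simp add: algebra_simps)
    moreover have "p dvd \<dots>" using d p_dvd by (intro dvd_diff) auto
    ultimately have "p dvd \<iota> b * t^2 * sg (k + 5) * sg (k + 2)" by simp
    thus False using nd 1 by (simp add: iff)
  qed
  show 3: "\<not> p dvd sg (k + 7)"
  proof
    assume d: "p dvd sg (k + 7)"
    have i: "k + 2 + 5 = k + 7" "k + 2 + 4 = k + 6" "k + 2 + 3 = k + 5" "k + 2 + 2 = k + 4" "k + 2 + 1 = k + 3" by auto
    have "\<iota> b * t^2 * sg (k + 6) * sg (k + 3) = - (sg (k + 7) * sg (k + 2)) - sg (k + 4) * (J * sg (k + 5))"
      unfolding somos_rel[of "k + 2", unfolded somos_rel_def i] by (simp add: algebra_simps)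
    moreover have "p dvd \<dots>" using d p_dvd by (intro dvd_diff) auto
    ultimately have "p dvd \<iota> b * t^2 * sg (k + 6) * sg (k + 3)" by simp
    thus False using nd 2 by (simp add: iff)
  qed
qed

text \<open>At a zero of the orbit the conserved quantity determines the neighbouring value. This
  serves on both sides of the singularity.\<close>

lemma I_cong:
  assumes "x \<in> max_ideal p" "y \<in> local_ring p"
  shows "residue_eq p (x * y * (x + y - C a) - C b * (x + y)) (- C b * y)"
proof -
  have "x * y * (x + y - C a) - C b * (x + y) - (- C b * y) = x * (y * (x + y - C a) - C b)"
    by (simp add: algebra_simps)
  moreover have "y * (x + y - C a) - C b \<in> local_ring p"
    using assms p max_ideal_local_ring by (intro local_ring_diff local_ring_mult local_ring_add local_ring_to_fract) auto
  ultimately show ?thesis unfolding residue_eq_def using max_ideal_mult(1)[OF p assms(1)] by metis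
qed

lemma I_solve:
  assumes "residue_eq p z (- C b * y)"
  shows "residue_eq p y (- z * C (1 / b))"
proof -
  have "y - (- z * C (1 / b)) = (z - (- C b * y)) * C (1 / b)"
    using C_neq0[OF b_neq0] b_neq0 C_hom(4) by (simp add: C_divide field_simps)
  thus ?thesis using assms max_ideal_mult(1)[OF p _ local_ring_to_fract[OF p]] unfolding residue_eq_def by metis
qed

text \<open>If \<open>I\<close> were a constant modulo \<open>p\<close>, then so would be
  \<open>w k\<close>, next to the zero \<open>w (k + 1)\<close>. The reversed recurrence would carry
  constancy down to \<open>w 1\<close> and \<open>w 0\<close>, against
  \<open>no_common_prime\<close>.\<close>

lemma I_transcendental: "\<not> residue_eq p (I 0) (C \<kappa>)"
proof
  assume "residue_eq p (I 0) (C \<kappa>)"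
  hence c: "residue_eq p (C \<kappa>) (I k)" using I_const[of k] residue_eq_sym by metis
  have wl: "w i \<in> local_ring p" if "i \<le> k + 1" for i
    using w_local_ring(1)[OF p p_ndvd_t, of i] p_ndvd[of "i + 1"] p_ndvd[of "i + 2"] that by simp
  have wu: "w i \<notin> max_ideal p" if "i \<le> k" "i \<ge> 1" for i
    using w_local_ring(2)[OF p p_ndvd_t, of i] p_ndvd[of "i + 1"] p_ndvd[of "i + 2"] p_ndvd[of "i + 3"] p_ndvd[of i] that by simp
  have w1: "w (k + 1) \<in> max_ideal p"
  proof -
    have i: "k + 1 + 1 = k + 2" "k + 1 + 2 = k + 3" "k + 1 + 3 = k + 4" by auto
    show ?thesis using w_local_ring(2)[OF p p_ndvd_t, of "k + 1", unfolded i] p_ndvd[of "k + 2"] p_ndvd[of "k + 3"] p_dvd by simp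
  qed
  have "I k = w (k + 1) * w k * (w (k + 1) + w k - C a) - C b * (w (k + 1) + w k)"
    unfolding I_def by (simp add: algebra_simps)
  hence "residue_eq p (I k) (- C b * w k)" using I_cong[OF w1 wl[of k]] by simp
  hence "residue_eq p (C \<kappa>) (- C b * w k)" using c residue_eq_trans[OF p] by blast
  hence "residue_eq p (w k) (- C \<kappa> * C (1 / b))" by (rule I_solve)
  hence wk: "residue_eq p (w k) (C (- \<kappa> * (1 / b)))" by (simp only: C_hom(2) C_uminus)
  \<comment> \<open>The subtraction is truncated, so from \<open>i = k\<close> on the claim stays at
    the pair \<open>w 0\<close>, \<open>w 1\<close>.\<close>
  have "\<exists>x y. residue_eq p (w (k - i)) (C x) \<and> residue_eq p (w (k - i + 1)) (C y)" for i
  proof (induction i)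
    case 0
    have "residue_eq p (w (k + 1)) (C 0)" unfolding residue_eq_def C_hom using w1 by simp
    thus ?case using wk by auto
  next
    case (Suc i)
    then obtain x y where xy: "residue_eq p (w (k - i)) (C x)" "residue_eq p (w (k - i + 1)) (C y)" by blast
    show ?case
    proof (cases "i < k")
      case True
      define j where "j = k - Suc i"
      have j: "k - i = j + 1" "k - i + 1 = j + 2" "j + 1 \<le> k" unfolding j_def using True by auto
      have wj: "w (j + 1) \<notin> max_ideal p" "w (j + 1) \<in> local_ring p" using wu[of "j + 1"] wl[of "j + 1"] j by auto
      have x0: "x \<noteq> 0"
      proof
        assume "x = 0"
        hence "w (j + 1) \<in> max_ideal p" using xy(1) unfolding j residue_eq_def C_hom \<open>x = 0\<close> by simp
        with wj show False by simp
      qed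
      have e: "w j = C a + C b * inverse (w (j + 1)) - w (j + 1) - w (j + 2)"
        unfolding w_rec by (simp add: field_simps)
      have "residue_eq p (w j) (C a + C b * inverse (C x) - C x - C y)"
        unfolding e using xy j wj x0 p
        by (intro residue_eq_diff residue_eq_add residue_eq_mult residue_eq_inverse residue_eq_refl local_ring_inverse local_ring_to_fract C_unit) auto
      also have "C b * inverse (C x) = C (b / x)"
        by (subst C_divide[OF x0]) (simp only: divide_inverse)
      also have "C a + C (b / x) - C x - C y = C (a + b / x - x - y)"
        by (simp only: C_diff C_hom)
      finally show ?thesis using xy(1) j unfolding j_def by auto
    next
      case False
      thus ?thesis using xy by auto
    qed
  qed
  from this[of k] obtain x y where xy: "residue_eq p (w 0) (C x)" "residue_eq p (w 1) (C y)" by auto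
  have sg4: "sg (1 + 3) = U" "sg (1 + 2) = 1" "sg (1 + 1) = 1" "sg (0 + 3) = 1" "sg (0 + 2) = 1" "sg (0 + 1) = 1"
    by (simp_all add: eval_nat_numeral)
  have T: "to_fract t \<noteq> 0" using t_neq0 by simp
  have "w 0 - C x = to_fract (V - \<iota> x * t) / to_fract t"
    unfolding w_def sg4 using T by (simp add: field_simps)
  hence "p dvd V - \<iota> x * t" using max_ideal_quot_iff[OF p p_ndvd_t] xy unfolding residue_eq_def by metis
  moreover have "w 1 - C y = to_fract (U - \<iota> y * t) / to_fract t"
    unfolding w_def sg4 sg_init using T by (simp add: field_simps)
  hence "p dvd U - \<iota> y * t" using max_ideal_quot_iff[OF p p_ndvd_t] xy unfolding residue_eq_def by metis
  ultimately show False using no_common_prime[OF p] by blast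
qed

text \<open>After the singularity the solution agrees modulo \<open>p\<close> with the generic orbit
  of 0, \<open>s\<close>, whose later terms are nonzero because \<open>s\<close> is
  transcendental.\<close>

lemma p_ndvd_later: "1 \<le> i \<Longrightarrow> \<not> p dvd sg (k + 4 + i)"
proof -
  define s where "s = - I 0 * C (1 / b)"
  define m where "m = k + 4"
  let ?N = "\<lambda>j. ev s (orbit_num a b j)" and ?D = "\<lambda>j. ev s (orbit_den a b j)"
  have nd3: "\<not> p dvd sg (m + 1)" "\<not> p dvd sg (m + 2)" "\<not> p dvd sg (m + 3)"
    using p_ndvd_next unfolding m_def by (simp_all add: add.commute)
  have wm: "w m \<in> max_ideal p" using w_local_ring[OF p p_ndvd_t nd3(1,2)] p_dvd unfolding m_def by simp
  have i: "m + 1 + 1 = m + 2" "m + 1 + 2 = m + 3" by auto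
  have wm1: "w (m + 1) \<in> local_ring p" using w_local_ring(1)[OF p p_ndvd_t, of "m + 1", unfolded i] nd3 by blast
  have "residue_eq p (I m) (- C b * w (m + 1))"
    unfolding I_def using I_cong[OF wm wm1] by simp
  hence ws: "residue_eq p (w (m + 1)) s"
    unfolding s_def using I_solve I_const[of m] by metis
  have s_local_ring: "s \<in> local_ring p" using ws wm1 residue_eq_local_ring[OF p] by blast
  have s_trans: "\<not> residue_eq p s (C \<kappa>)" for \<kappa>
  proof
    assume c: "residue_eq p s (C \<kappa>)"
    have "I 0 - C (- b * \<kappa>) = (s - C \<kappa>) * (- C b)"
      unfolding s_def C_hom C_uminus using C_neq0[OF b_neq0] b_neq0
      by (simp add: C_divide C_hom field_simps)
    moreover have "\<dots> \<in> max_ideal p" using c max_ideal_mult(1)[OF p _ local_ring_uminus[OF local_ring_to_fract[OF p]]] unfolding residue_eq_def by blast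
    ultimately have "residue_eq p (I 0) (C (- b * \<kappa>))" unfolding residue_eq_def by metis
    thus False using I_transcendental by blast
  qed
  have NL: "?N j \<in> local_ring p" "?D j \<in> local_ring p" for j using ev_local_ring[OF p s_local_ring] by auto
  have NU: "?N j \<notin> max_ideal p" if "j > 0" for j
    using ev_unit[OF p s_local_ring s_trans] orbit_num_den_nonzero[OF b_neq0, of a j] that by blast
  \<comment> \<open>The congruences are cross-multiplied to avoid quotients. The entries up to
    \<open>m + j + 3\<close> make \<open>w (m + j + 1)\<close> integral at \<open>p\<close>; as
    \<open>?N (Suc j)\<close> is a unit there, \<open>p\<close> cannot divide
    \<open>sg (m + j + 4)\<close>.\<close>
  have main: "(\<forall>i. 1 \<le> i \<and> i \<le> j + 3 \<longrightarrow> \<not> p dvd sg (m + i)) \<and>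
      w (m + j) * ?D j - ?N j \<in> max_ideal p \<and> w (m + j + 1) * ?D (Suc j) - ?N (Suc j) \<in> max_ideal p" for j
  proof (induction j)
    case 0
    have "i = 1 \<or> i = 2 \<or> i = 3" if "1 \<le> i \<and> i \<le> 0 + 3" for i :: nat using that by auto
    hence "\<forall>i. 1 \<le> i \<and> i \<le> 0 + 3 \<longrightarrow> \<not> p dvd sg (m + i)" using nd3 by metis
    thus ?case using wm ws by (simp add: ev_simps C_hom residue_eq_def)
  next
    case (Suc j)
    define W where "W = w (m + j + 1)"
    define X where "X = w (m + j)"
    have IH: "X * ?D j - ?N j \<in> max_ideal p" "W * ?D (Suc j) - ?N (Suc j) \<in> max_ideal p"
      and nd: "1 \<le> i \<Longrightarrow> i \<le> j + 3 \<Longrightarrow> \<not> p dvd sg (m + i)" for i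
      using Suc unfolding W_def X_def by auto
    have i: "m + j + 1 + 1 = m + (j + 2)" "m + j + 1 + 2 = m + (j + 3)" "m + j + 1 + 3 = m + (j + 4)"
      "m + j + 1 = m + (j + 1)" by auto
    have nds: "\<not> p dvd sg (m + j + 1 + 1)" "\<not> p dvd sg (m + j + 1 + 2)" unfolding i(1,2) using nd[of "j + 2"] nd[of "j + 3"] by simp_all
    have Wl: "W \<in> local_ring p" unfolding W_def using w_local_ring(1)[OF p p_ndvd_t nds] .
    have Wu: "W \<notin> max_ideal p"
    proof
      assume "W \<in> max_ideal p"
      hence "W * ?D (Suc j) \<in> max_ideal p" using max_ideal_mult(1)[OF p _ NL(2)] by blast
      hence "?N (Suc j) \<in> max_ideal p" using max_ideal_diff[OF p _ IH(2)] by fastforce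
      thus False using NU[of "Suc j"] by simp
    qed
    hence nd4: "\<not> p dvd sg (m + (j + 4))"
      unfolding W_def using w_local_ring(2)[OF p p_ndvd_t nds] unfolding i(3) by blast
    have A: "\<not> p dvd sg (m + i)" if "1 \<le> i" "i \<le> Suc j + 3" for i
    proof (cases "i = j + 4")
      case False
      thus ?thesis using nd[of i] that by auto
    qed (use nd4 in simp)
    have rec: "w (m + Suc j + 1) = C a + C b * inverse W - W - X"
      using w_rec[of "m + j"] unfolding W_def X_def by (simp add: field_simps)
    have W0: "W \<noteq> 0" unfolding W_def by (rule w_neq0)
    \<comment> \<open>The new error is a combination of the two previous ones with coefficients in
      \<open>local_ring p\<close>.\<close>
    have "w (m + Suc j + 1) * ?D (Suc (Suc j)) - ?N (Suc (Suc j)) =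
       (- (W * ?D (Suc j) - ?N (Suc j))) * (C b * inverse W * ?D (Suc j) * ?D j)
       - (W * ?D (Suc j) - ?N (Suc j)) * (?N (Suc j) * ?D j)
       - (X * ?D j - ?N j) * (?N (Suc j) * ?D (Suc j))"
      unfolding rec using W0 by (simp add: ev_simps power2_eq_square field_simps)
    moreover have "\<dots> \<in> max_ideal p"
      by (intro max_ideal_diff[OF p] max_ideal_mult(1)[OF p] max_ideal_uminus IH local_ring_mult[OF p] NL local_ring_inverse[OF Wl Wu] local_ring_to_fract[OF p])
    ultimately have "w (m + Suc j + 1) * ?D (Suc (Suc j)) - ?N (Suc (Suc j)) \<in> max_ideal p" by simp
    thus ?case using A IH(2) unfolding W_def by auto
  qed
  show "1 \<le> i \<Longrightarrow> \<not> p dvd sg (k + 4 + i)"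
    using main[of i] unfolding m_def by auto
qed

end

lemma prime_dvd_sg_unique:
  assumes "prime_elem p" "1 \<le> i" "1 \<le> j" "p dvd sg i" "p dvd sg j"
  shows "i = j"
proof -
  define m where "m = (LEAST i. 1 \<le> i \<and> p dvd sg i)"
  have m: "1 \<le> m" "p dvd sg m" using LeastI[of "\<lambda>i. 1 \<le> i \<and> p dvd sg i" i] assms unfolding m_def by auto
  have least: "\<not> p dvd sg i" if "1 \<le> i" "i < m" for i
    using not_less_Least[of i "\<lambda>i. 1 \<le> i \<and> p dvd sg i"] that unfolding m_def by auto
  have "m \<noteq> 1" "m \<noteq> 2" "m \<noteq> 3"
    using m sg_init prime_elem_not_unit[OF assms(1)] by (auto simp del: sg.simps)
  hence mk: "m = (m - 4) + 4" using m by auto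
  have later: "\<not> p dvd sg (m + i)" if "1 \<le> i" for i
    using p_ndvd_later[OF assms(1), of "m - 4" i] least m(2) that unfolding mk[symmetric] by auto
  have "l = m" if "1 \<le> l" "p dvd sg l" for l
  proof (cases l m rule: linorder_cases)
    case greater
    hence "l = m + (l - m)" "1 \<le> l - m" by auto
    thus ?thesis using later[of "l - m"] that by metis
  qed (use least[of l] that in auto)
  thus ?thesis using assms by metis
qed

end

section \<open>Reduced coordinates of the iterates\<close>

context somos5_complex
begin

text \<open>As \<open>sg 1\<close>, \<open>sg 2\<close>, \<open>sg 3\<close> are 1,
  \<open>t * sg_prod (n + 4)\<close> is the denominator of the \<open>n\<close>-th iterate.\<close>

definition sg_prod :: "nat \<Rightarrow> 'a" where "sg_prod k = (\<Prod>j = 1..<k. sg j)"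

lemma sg_prod_Suc: "sg_prod (Suc (Suc k)) = sg_prod (Suc k) * sg (Suc k)"
  unfolding sg_prod_def by simp

lemma sg_prod_steps: "sg_prod (n + 2) = sg_prod (n + 1) * sg (n + 1)" "sg_prod (n + 3) = sg_prod (n + 1) * sg (n + 1) * sg (n + 2)"
  "sg_prod (n + 4) = sg_prod (n + 1) * sg (n + 1) * sg (n + 2) * sg (n + 3)"
  "sg_prod (n + 5) = sg_prod (n + 1) * sg (n + 1) * sg (n + 2) * sg (n + 3) * sg (n + 4)"
  using sg_prod_Suc[of n] sg_prod_Suc[of "n + 1"] sg_prod_Suc[of "n + 2"] sg_prod_Suc[of "n + 3"]
  by (simp_all add: eval_nat_numeral)

lemma sg_prod_neq0: "sg_prod k \<noteq> 0"
  unfolding sg_prod_def using sg_neq0 by simp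

lemma prime_dvd_sg_prod_iff:
  assumes "prime_elem p"
  shows "p dvd sg_prod k \<longleftrightarrow> (\<exists>j. 1 \<le> j \<and> j < k \<and> p dvd sg j)"
proof (induction k)
  case 0
  show ?case using assms prime_elem_not_unit[of p] by (simp add: sg_prod_def)
next
  case (Suc k)
  show ?case
  proof (cases k)
    case 0
    thus ?thesis using assms prime_elem_not_unit[of p] by (auto simp: sg_prod_def)
  next
    case (Suc l)
    thus ?thesis using Suc.IH assms
      by (auto simp: sg_prod_Suc prime_elem_dvd_mult_iff less_Suc_eq simp del: sg.simps)
  qed
qed

text \<open>
  \<open>xnum g z k / (t * sg_prod (k + 2))\<close> is the coordinate \<open>x\<close> of the iterate with index \<open>k - 2\<close>, where
  \<open>y\<close> and \<open>z\<close> count as \<open>x\<close> with indices \<open>-1\<close> and \<open>-2\<close>; \<open>g\<close> stands for \<open>c / d\<close>.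
\<close>

fun xnum :: "'a \<Rightarrow> 'a \<Rightarrow> nat \<Rightarrow> 'a" where
  "xnum g z 0 = z"
| "xnum g z (Suc k) = - sg (k + 2) * xnum g z k + sg (k + 3) * sg k * sg_prod (k + 1) - g * t * sg_prod (k + 3)"

lemma xnum_1: "xnum g z 1 = V - z - g * t"
  unfolding One_nat_def xnum.simps(2)[of g z 0] by (simp add: eval_nat_numeral sg_prod_def)

lemma xnum_2: "xnum g z 2 = U - V + z"
proof -
  have "xnum g z 2 = xnum g z (Suc 1)" by (simp add: eval_nat_numeral)
  also have "\<dots> = U - V + z"
    unfolding xnum.simps(2)[of g z 1] xnum_1 by (simp add: eval_nat_numeral sg_prod_def atLeastLessThanSuc)
  finally show ?thesis .
qed

text \<open>Three consecutive affine coordinates brought to the denominator of the first; the extra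
  factors \<open>sg\<close> extend the two smaller denominators.\<close>

definition reduced_quad :: "'a \<Rightarrow> 'a \<Rightarrow> nat \<Rightarrow> 'a \<times> 'a \<times> 'a \<times> 'a" where
  "reduced_quad g z n = (xnum g z (n + 2), xnum g z (n + 1) * sg (n + 3), xnum g z n * sg (n + 3) * sg (n + 2), t * sg_prod (n + 4))"

fun scale_quad :: "'a \<Rightarrow> 'a \<times> 'a \<times> 'a \<times> 'a \<Rightarrow> 'a \<times> 'a \<times> 'a \<times> 'a" where
  "scale_quad h (p, q, r, s) = (h * p, h * q, h * r, h * s)"

lemma phi_scale: "phi pa pb pc pd (scale_quad h v) = scale_quad (h^2) (phi pa pb pc pd v)"
  by (cases v) (simp add: algebra_simps power2_eq_square)

text \<open>\<open>D / T\<close> and \<open>D' / T\<close> are two consecutive w. Divided by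
  \<open>pd * D * T\<close>, the identity reads x' + x + g = \<alpha> + \<beta>/w - w - w', so the
  map is the recurrence.\<close>

lemma phi_algebra:
  fixes X :: 'a
  assumes XY: "X + Y = D - g * T" and YZ: "Y + Z = D' - g * T" and c: "pc = pd * g"
    and \<alpha>: "pd * \<alpha> = 4 * pc - pb" and \<beta>: "pd * \<beta> = - (pa - pb * g + pd * g^2)"
  shows "- pa * T^2 - pb * (X + Y) * T - pc * (X + Y + Z) * T - pd * (X + Y) * (2 * X + 2 * Y + Z)
    = pd * (- D * X - D * D - D * D' - g * D * T) + (pd * \<alpha>) * D * T + (pd * \<beta>) * T^2"
proof -
  have Y: "Y = D - g * T - X" using XY by (simp add: algebra_simps)
  have Z: "Z = D' - D + X" using YZ unfolding Y by (simp add: algebra_simps)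
  show ?thesis unfolding \<alpha> \<beta> c Z Y by (simp add: algebra_simps power2_eq_square)
qed

text \<open>The factor \<open>pc * t + pd * (x + y)\<close> of the map becomes
  \<open>pd * sg (n + 1) * sg_prod (n + 2) * sg (n + 4)\<close>. Only \<open>sg (n + 4)\<close>
  enters the new denominator; the rest is common to all coordinates, to the first one by
  \<open>sum_rel\<close>.\<close>

lemma phi_quad:
  assumes c: "pc = pd * g" and \<alpha>: "pd * \<iota> a = 4 * pc - pb" and \<beta>: "pd * \<iota> b = - (pa - pb * g + pd * g^2)"
  shows "phi pa pb pc pd (reduced_quad g z n) = scale_quad (pd * sg (n + 1) * sg_prod (n + 2)) (reduced_quad g z (n + 1))"
proof -
  define s0 s1 s2 s3 s4 s5 where s: "s0 = sg n" "s1 = sg (n + 1)" "s2 = sg (n + 2)" "s3 = sg (n + 3)" "s4 = sg (n + 4)" "s5 = sg (n + 5)"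
  define e where "e = sg_prod (n + 1)"
  define R Q P P' where x: "R = xnum g z n" "Q = xnum g z (n + 1)" "P = xnum g z (n + 2)" "P' = xnum g z (n + 3)"
  define T where "T = t * e * s1 * s2 * s3"
  define D where "D = s4 * s1^2 * e"
  define D' where "D' = s3^2 * s0 * e"
  have i: "n + 1 + 1 = n + 2" "n + 1 + 2 = n + 3" "n + 1 + 3 = n + 4" "n + 1 + 4 = n + 5"
    "n + 2 + 1 = n + 3" "n + 2 + 2 = n + 4" "n + 2 + 3 = n + 5"
    "Suc n = n + 1" "Suc (n + 1) = n + 2" "Suc (n + 2) = n + 3" by auto
  note sg_prod = sg_prod_steps[of n, folded s e_def]
  have Q: "Q = - s2 * R + s3 * s0 * e - g * t * (e * s1 * s2)"
    using xnum.simps(2)[of g z n] unfolding i sg_prod x e_def[symmetric] s[symmetric] by simp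
  have P: "P = - s3 * Q + s4 * s1 * (e * s1) - g * t * (e * s1 * s2 * s3)"
    using xnum.simps(2)[of g z "n + 1"] unfolding i sg_prod x e_def[symmetric] s[symmetric] by simp
  have P': "P' = - s4 * P + s5 * s2 * (e * s1 * s2) - g * t * (e * s1 * s2 * s3 * s4)"
    using xnum.simps(2)[of g z "n + 2"] unfolding i sg_prod x e_def[symmetric] s[symmetric] by simp
  have XY: "P + Q * s3 = D - g * T" unfolding P D_def T_def by (simp add: algebra_simps power2_eq_square)
  have YZ: "Q * s3 + R * s3 * s2 = D' - g * T" unfolding Q D'_def T_def by (simp add: algebra_simps power2_eq_square)
  have "pc * T + pd * (P + Q * s3) = pd * D" unfolding XY c by (simp add: algebra_simps)
  also have "\<dots> = pd * s1 * (e * s1) * s4" unfolding D_def by (simp add: algebra_simps power2_eq_square)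
  finally have lin: "pc * T + pd * (P + Q * s3) = pd * s1 * (e * s1) * s4" .
  have E: "s5 * s2^2 * s1 = - (s4^2 * s1^2) - s4 * s3^2 * s0 + \<iota> a * t * s4 * s3 * s2 * s1 + \<iota> b * t^2 * s3^2 * s2^2"
    using sum_rel[of n] unfolding sum_rel_def s by simp
  have "pd * s1 * (e * s1) * P' = - pd * D * P - pd * g * D * T + pd * (e^2 * s1^2) * (s5 * s2^2 * s1)"
    unfolding P' D_def T_def by (simp add: algebra_simps power2_eq_square)
  also have "\<dots> = pd * (- D * P - D * D - D * D' - g * D * T) + (pd * \<iota> a) * D * T + (pd * \<iota> b) * T^2"
    unfolding E D_def D'_def T_def by (simp add: algebra_simps power2_eq_square)
  also have "\<dots> = - pa * T^2 - pb * (P + Q * s3) * T - pc * (P + Q * s3 + R * s3 * s2) * T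
      - pd * (P + Q * s3) * (2 * P + 2 * (Q * s3) + R * s3 * s2)"
    using phi_algebra[OF XY YZ c \<alpha> \<beta>] by simp
  finally have first: "- pa * T^2 - pb * (P + Q * s3) * T - pc * (P + Q * s3 + R * s3 * s2) * T
      - pd * (P + Q * s3) * (2 * P + 2 * (Q * s3) + R * s3 * s2) = pd * s1 * (e * s1) * P'" ..
  have TT: "t * (e * s1 * s2 * s3) = T" by (simp add: T_def mult.assoc)
  have T': "t * (e * s1 * s2 * s3 * s4) = T * s4" by (simp add: T_def mult.assoc)
  have q: "reduced_quad g z n = (P, Q * s3, R * s3 * s2, T)"
    unfolding reduced_quad_def sg_prod x[symmetric] s[symmetric] TT ..
  have q': "reduced_quad g z (n + 1) = (P', P * s4, Q * s4 * s3, T * s4)"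
    unfolding reduced_quad_def i sg_prod x[symmetric] s[symmetric] T' ..
  show ?thesis
    unfolding q q' sg_prod s[symmetric] phi.simps scale_quad.simps first lin by (simp add: mult_ac)
qed

lemma phi_iterate_quad:
  assumes "pc = pd * g" "pd * \<iota> a = 4 * pc - pb" "pd * \<iota> b = - (pa - pb * g + pd * g^2)" "pd \<noteq> 0"
  shows "\<exists>h. h \<noteq> 0 \<and> (phi pa pb pc pd ^^ n) (reduced_quad g z 0) = scale_quad h (reduced_quad g z n)"
proof (induction n)
  case 0
  show ?case by (intro exI[of _ 1]) (simp add: reduced_quad_def)
next
  case (Suc n)
  then obtain h where h: "h \<noteq> 0" "(phi pa pb pc pd ^^ n) (reduced_quad g z 0) = scale_quad h (reduced_quad g z n)" by blast
  define h' where "h' = h^2 * (pd * sg (n + 1) * sg_prod (n + 2))"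
  have "scale_quad u (scale_quad v q) = scale_quad (u * v) q" for u v q
    by (cases q) (simp add: mult.assoc)
  hence "(phi pa pb pc pd ^^ Suc n) (reduced_quad g z 0) = scale_quad h' (reduced_quad g z (Suc n))"
    using h(2) phi_quad[OF assms(1-3)] by (simp add: phi_scale h'_def)
  moreover have "h' \<noteq> 0" unfolding h'_def using h assms(4) sg_neq0 sg_prod_neq0 by simp
  ultimately show ?case by blast
qed

text \<open>Only the two w with \<open>sg m\<close> in the denominator have a pole at
  \<open>p\<close>, and the recurrence makes their polar parts opposite, say rho and -rho. Each x is
  w minus the previous x, up to a constant, so its polar part is rho, then -2 rho, and afterwards
  only changes sign.\<close>

lemma xnum_sg_prod_coprime:
  assumes p: "prime_elem p" and "p dvd sg_prod (k + 2)"
  shows "\<not> p dvd xnum g z k"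
proof -
  note iff = prime_elem_dvd_mult_iff[OF p] prime_elem_dvd_power_iff[OF p]
  from assms obtain m where m: "1 \<le> m" "m < k + 2" "p dvd sg m" unfolding prime_dvd_sg_prod_iff[OF p] by blast
  have uniq: "\<not> p dvd sg i" if "1 \<le> i" "i \<noteq> m" for i
    using prime_dvd_sg_unique[OF p _ _ _ m(3)] m(1) that by blast
  have "m \<noteq> 1" "m \<noteq> 2" "m \<noteq> 3"
    using m sg_init prime_elem_not_unit[OF p] by (auto simp del: sg.simps)
  hence m4: "4 \<le> m" using m(1) by auto
  then obtain r where r: "m = r + 4" by (metis add.commute le_Suc_ex)
  have pSp: "p dvd sg_prod i \<longleftrightarrow> m < i" for i
    unfolding prime_dvd_sg_prod_iff[OF p] using m uniq by blast
  \<comment> \<open>2 is the image of a nonzero constant, so no prime divides it; this keeps -2 rho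
    from vanishing.\<close>
  have "\<iota> 2 = 2" using \<iota>_add[of 1 1] \<iota>_1 by simp
  hence "\<not> p dvd 2"
    using C_unit[OF p, of 2] max_ideal_to_fract[OF p, of 2] by auto
  have i: "Suc (r + 2) = r + 3" "r + 2 + 2 = r + 4" "r + 2 + 3 = r + 5" "r + 2 + 1 = r + 3"
    "Suc (r + 3) = r + 4" "r + 3 + 2 = r + 5" "r + 3 + 3 = r + 6" "r + 3 + 1 = r + 4"
    "r + 1 + 5 = r + 6" "r + 1 + 4 = r + 5" "r + 1 + 1 = r + 2" "r + 1 + 3 = r + 4" "r + 1 + 2 = r + 3" by auto
  have x3: "xnum g z (r + 3) = sg (r + 5) * sg (r + 2) * sg_prod (r + 3) + (- sg (r + 4) * xnum g z (r + 2) - g * t * sg_prod (r + 5))"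
    using xnum.simps(2)[of g z "r + 2"] unfolding i by simp
  have d3: "p dvd - sg (r + 4) * xnum g z (r + 2) - g * t * sg_prod (r + 5)"
    using m(3) pSp[of "r + 5"] unfolding r by (intro dvd_diff dvd_mult dvd_mult2) auto
  have "\<not> p dvd sg (r + 5) * sg (r + 2) * sg_prod (r + 3)"
    using uniq[of "r + 5"] uniq[of "r + 2"] pSp[of "r + 3"] unfolding r iff by simp
  hence n3: "\<not> p dvd xnum g z (r + 3)"
    unfolding x3 using d3 dvd_add_left_iff by blast
  have Sp4: "sg_prod (r + 4) = sg_prod (r + 3) * sg (r + 3)"
    unfolding sg_prod_steps by simp
  \<comment> \<open>The factor \<open>sg (r + 2)\<close> produces the left side of
    \<open>sum_rel (r + 1)\<close>.\<close>
  have x4: "sg (r + 2) * xnum g z (r + 4) = - sg (r + 5) * sg (r + 2) * xnum g z (r + 3)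
    + sg (r + 6) * sg (r + 3)^2 * sg (r + 2) * sg_prod (r + 3) - g * t * sg_prod (r + 6) * sg (r + 2)"
    unfolding xnum.simps(2)[of g z "r + 3", unfolded i Sp4] by (simp add: algebra_simps power2_eq_square)
  have n4: "\<not> p dvd xnum g z (r + 4)"
  proof
    assume a: "p dvd xnum g z (r + 4)"
    have E: "sg (r + 6) * sg (r + 3)^2 * sg (r + 2) =
     - (sg (r + 5)^2 * sg (r + 2)^2) - sg (r + 5) * sg (r + 4)^2 * sg (r + 1)
     + \<iota> a * t * sg (r + 5) * sg (r + 4) * sg (r + 3) * sg (r + 2)
     + \<iota> b * t^2 * sg (r + 4)^2 * sg (r + 3)^2"
      using sum_rel[of "r + 1"] unfolding sum_rel_def i .
    have "2 * sg (r + 5)^2 * sg (r + 2)^2 * sg_prod (r + 3) =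
       - (sg (r + 2) * xnum g z (r + 4))
       - sg (r + 5) * sg (r + 2) * (- sg (r + 4) * xnum g z (r + 2) - g * t * sg_prod (r + 5))
       + sg (r + 4) * (sg_prod (r + 3) * (- (sg (r + 5) * sg (r + 4) * sg (r + 1))
           + \<iota> a * t * sg (r + 5) * sg (r + 3) * sg (r + 2) + \<iota> b * t^2 * sg (r + 4) * sg (r + 3)^2))
       - sg_prod (r + 6) * (g * t * sg (r + 2))"
      unfolding x4 x3 E by (simp add: algebra_simps power2_eq_square)
    moreover have "p dvd \<dots>"
      using a d3 m(3) pSp[of "r + 6"] unfolding r by (intro dvd_add dvd_diff) (auto intro: dvd_mult2)
    ultimately have "p dvd 2 * sg (r + 5)^2 * sg (r + 2)^2 * sg_prod (r + 3)" by simp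
    thus False using \<open>\<not> p dvd 2\<close> uniq[of "r + 5"] uniq[of "r + 2"] pSp[of "r + 3"] unfolding r iff by simp
  qed
  have "\<not> p dvd xnum g z (r + 4 + j)" for j
  proof (induction j)
    case (Suc j)
    have e: "r + 4 + Suc j = Suc (r + 4 + j)" by simp
    have "p dvd sg (r + 4 + j + 3) * sg (r + 4 + j) * sg_prod (r + 4 + j + 1) - g * t * sg_prod (r + 4 + j + 3)"
      using pSp[of "r + 4 + j + 1"] pSp[of "r + 4 + j + 3"] unfolding r by (intro dvd_diff dvd_mult) auto
    moreover have "xnum g z (r + 4 + Suc j) = - sg (r + 4 + j + 2) * xnum g z (r + 4 + j) +
      (sg (r + 4 + j + 3) * sg (r + 4 + j) * sg_prod (r + 4 + j + 1) - g * t * sg_prod (r + 4 + j + 3))"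
      unfolding e xnum.simps(2) by simp
    moreover have "\<not> p dvd - sg (r + 4 + j + 2) * xnum g z (r + 4 + j)"
      using Suc uniq[of "r + 4 + j + 2"] unfolding r iff dvd_minus_iff by simp
    ultimately show ?case using dvd_add_left_iff by metis
  qed (use n4 in simp)
  moreover have "k = r + 3 \<or> k = r + 4 + (k - (r + 4))" using m(2) r by auto
  ultimately show ?thesis using n3 by metis
qed

end

section \<open>Homogeneous polynomials in four variables\<close>

lemma coeff_two_power_mult: "coeff (2 ^ l * (q :: 'a::comm_semiring_1 poly)) k = 2 ^ l * coeff q k"
  by (induction l arbitrary: q) (simp_all add: mult.assoc mult_2 distrib_right)

lemma map_poly_hom_mult:
  assumes "h 0 = 0" "\<And>x y. h (x + y) = h x + h y" "\<And>x y. h (x * y) = h x * h y"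
  shows "map_poly h (p * q) = map_poly h p * map_poly h q"
proof (rule poly_eqI)
  fix n
  have "h (\<Sum>i\<le>n. coeff p i * coeff q (n - i)) = (\<Sum>i\<le>n. h (coeff p i * coeff q (n - i)))"
    using sum_comp_morphism[of h "\<lambda>i. coeff p i * coeff q (n - i)" "{..n}"] assms by (simp add: o_def)
  thus "coeff (map_poly h (p * q)) n = coeff (map_poly h p * map_poly h q) n"
    using assms by (simp add: coeff_map_poly coeff_mult)
qed

definition dilate :: "('a::comm_ring_1 \<Rightarrow> 'a) \<Rightarrow> 'a poly \<Rightarrow> 'a poly" where
  "dilate h p = map_poly h p \<circ>\<^sub>p [:0, 2:]"

definition is_hom :: "('a::comm_ring_1 \<Rightarrow> 'a) \<Rightarrow> bool" where
  "is_hom h \<longleftrightarrow> h 0 = 0 \<and> (\<forall>x y. h (x + y) = h x + h y) \<and> (\<forall>x y. h (x * y) = h x * h y)"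

lemma is_hom_dilate: "is_hom h \<Longrightarrow> is_hom (dilate h)"
proof -
  assume h: "is_hom h"
  have "map_poly h (p + q) = map_poly h p + map_poly h q" for p q
    using h by (intro poly_eqI) (simp add: coeff_map_poly is_hom_def)
  thus ?thesis using h map_poly_hom_mult[of h]
    unfolding is_hom_def dilate_def by (simp add: pcompose_add pcompose_mult)
qed

lemma coeff_dilate: "is_hom h \<Longrightarrow> coeff (dilate h p) i = 2 ^ i * h (coeff p i)"
  unfolding dilate_def by (simp add: coeff_pcompose_linear coeff_map_poly is_hom_def)

text \<open>
  Since 2 is not a root of unity, the substitution that doubles all four variables detects
  homogeneity; as a ring homomorphism it also settles exact quotients.
\<close>

definition scale4 :: "cpoly4 \<Rightarrow> cpoly4" where
  "scale4 = dilate (dilate (dilate (dilate (\<lambda>x. x))))"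

lemma is_hom_id: "is_hom (\<lambda>x. x)"
  by (simp add: is_hom_def)

lemma scale4_hom: "scale4 (p * q) = scale4 p * scale4 q" "scale4 (p + q) = scale4 p + scale4 q"
  using is_hom_dilate[OF is_hom_dilate[OF is_hom_dilate[OF is_hom_dilate[OF is_hom_id]]]]
  unfolding scale4_def is_hom_def by blast+

lemma coeff4_scale4: "coeff4 (scale4 p) i j k l = 2 ^ (i + j + k + l) * coeff4 p i j k l"
  unfolding scale4_def coeff4_def
  by (simp add: coeff_dilate is_hom_dilate is_hom_id coeff_two_power_mult power_add)

lemma coeff4_two_power_mult: "coeff4 (2 ^ m * p) i j k l = 2 ^ m * coeff4 p i j k l"
  unfolding coeff4_def by (simp add: coeff_two_power_mult)

lemma cpoly4_eq_iff: "p = q \<longleftrightarrow> (\<forall>i j k l. coeff4 p i j k l = coeff4 q i j k l)"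
  unfolding coeff4_def poly_eq_iff by blast

lemma two_power_inject: "(2 :: complex) ^ m = 2 ^ n \<longleftrightarrow> m = n"
proof
  assume "(2 :: complex) ^ m = 2 ^ n"
  hence "of_nat (2 ^ m) = (of_nat (2 ^ n) :: complex)" by simp
  thus "m = n" by (simp only: of_nat_eq_iff power_inject_exp)
qed simp

lemma homogeneous4_iff_scale4: "homogeneous4 m p \<longleftrightarrow> scale4 p = 2 ^ m * p"
  unfolding homogeneous4_def cpoly4_eq_iff coeff4_scale4 coeff4_two_power_mult
  by (auto simp: two_power_inject)

lemma homogeneous4_mult: "homogeneous4 m p \<Longrightarrow> homogeneous4 n q \<Longrightarrow> homogeneous4 (m + n) (p * q)"
  unfolding homogeneous4_iff_scale4 scale4_hom by (simp add: power_add mult_ac)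

lemma homogeneous4_add: "homogeneous4 m p \<Longrightarrow> homogeneous4 m q \<Longrightarrow> homogeneous4 m (p + q)"
  unfolding homogeneous4_iff_scale4 scale4_hom by (simp add: algebra_simps)

lemma homogeneous4_uminus: "homogeneous4 m p \<Longrightarrow> homogeneous4 m (- p)"
  unfolding homogeneous4_def coeff4_def by simp

lemma homogeneous4_diff: "homogeneous4 m p \<Longrightarrow> homogeneous4 m q \<Longrightarrow> homogeneous4 m (p - q)"
  using homogeneous4_add[of m p "- q"] homogeneous4_uminus[of m q] by simp

lemma homogeneous4_quotient:
  assumes "homogeneous4 (m + n) (p * q)" "homogeneous4 n q" "q \<noteq> 0"
  shows "homogeneous4 m p"
proof -
  have "scale4 p * (2 ^ n * q) = (2 ^ m * p) * (2 ^ n * q)"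
    using assms unfolding homogeneous4_iff_scale4 scale4_hom by (simp add: power_add mult_ac)
  thus ?thesis using assms(3) unfolding homogeneous4_iff_scale4 by simp
qed

lemma homogeneous4_const4: "homogeneous4 0 (const4 c)"
  unfolding homogeneous4_def coeff4_def const4_def
  by (auto simp: coeff_pCons split: nat.splits if_splits)

lemma homogeneous4_1: "homogeneous4 0 1"
  using homogeneous4_const4[of 1] by (simp add: const4_def one_pCons)

lemma homogeneous4_var:
  "homogeneous4 1 var_x" "homogeneous4 1 var_y" "homogeneous4 1 var_z" "homogeneous4 1 var_t"
  unfolding homogeneous4_def coeff4_def var_x_def var_y_def var_z_def var_t_def one_pCons
  by (auto simp: coeff_pCons split: nat.splits if_splits)

lemma homogeneous4_unique:
  assumes "homogeneous4 m p" "homogeneous4 n p" "p \<noteq> 0"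
  shows "m = n"
proof -
  obtain i j k l where "coeff4 p i j k l \<noteq> 0"
    using assms(3) unfolding cpoly4_eq_iff by (auto simp: coeff4_def)
  thus ?thesis using assms(1,2) unfolding homogeneous4_def by metis
qed

section \<open>Evaluation, constants and linear forms\<close>

lemma eval4_hom:
  "eval4 (p + q) x y z t = eval4 p x y z t + eval4 q x y z t"
  "eval4 (p - q) x y z t = eval4 p x y z t - eval4 q x y z t"
  "eval4 (p * q) x y z t = eval4 p x y z t * eval4 q x y z t"
  "eval4 (- p) x y z t = - eval4 p x y z t"
  "eval4 0 x y z t = 0" "eval4 1 x y z t = 1" "eval4 (p ^ n) x y z t = eval4 p x y z t ^ n"
  by (simp_all add: eval4_def poly_power)

lemma eval4_numeral: "eval4 (numeral m) x y z t = numeral m"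
  by (simp add: eval4_def)

lemma eval4_vars:
  "eval4 var_x x y z t = x" "eval4 var_y x y z t = y" "eval4 var_z x y z t = z" "eval4 var_t x y z t = t"
  "eval4 (const4 c) x y z t = c"
  by (simp_all add: eval4_def var_x_def var_y_def var_z_def var_t_def const4_def)

lemma const4_hom:
  "const4 (x + y) = const4 x + const4 y" "const4 (x * y) = const4 x * const4 y" "const4 1 = 1"
  "const4 (x - y) = const4 x - const4 y" "const4 (- x) = - const4 x"
  by (simp_all add: const4_def one_pCons)

lemma const4_numeral: "const4 (numeral n) = numeral n"
  by (simp add: const4_def numeral_poly)

lemma unit_cpoly4: "is_unit p \<Longrightarrow> \<exists>c. p = const4 c"
  unfolding const4_def by (auto simp: is_unit_poly_iff)

lemma var_t_dvd_iff: "var_t dvd p \<longleftrightarrow> poly p 0 = 0"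
  unfolding poly_eq_0_iff_dvd var_t_def by simp

lemma prime_var_t: "prime_elem var_t"
proof (rule prime_elemI)
  show "var_t \<noteq> 0" by (simp add: var_t_def)
  show "\<not> is_unit var_t" unfolding var_t_dvd_iff by (auto simp: var_t_def is_unit_poly_iff)
qed (simp add: var_t_dvd_iff)

lemma var_t_dvd_eval4: "var_t dvd p \<Longrightarrow> eval4 p x y z 0 = 0"
  by (auto elim!: dvdE simp: eval4_hom eval4_vars)

text \<open>A combination free of \<open>t\<close> forces a common divisor to be free of
  \<open>t\<close>. It then divides the coefficients \<open>k\<close> and \<open>l\<close> of
  \<open>t\<close>, one of which is a unit; if both vanish, the same argument is run with
  \<open>z\<close>.\<close>

lemma linear_forms_coprime:
  assumes p1: "p dvd var_x + var_y + const4 k * var_t" and p2: "p dvd var_y + var_z + const4 l * var_t"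
  shows "is_unit p"
proof -
  have q1: "var_x + var_y + const4 k * var_t = [:[:[:[:0, 1:], 1:]:], [:[:[:k:]:]:]:]"
    by (simp add: var_x_def var_y_def var_t_def const4_def)
  have q2: "var_y + var_z + const4 l * var_t = [:[:[:0, 1:], 1:], [:[:[:l:]:]:]:]"
    by (simp add: var_z_def var_y_def var_t_def const4_def one_pCons)
  show ?thesis
  proof (cases "k = 0 \<and> l = 0")
    case True
    have "degree p = 0" using p1 dvd_imp_degree_le[OF p1] True unfolding q1 by simp
    then obtain r where r: "p = [:r:]" by (auto elim: degree_eq_zeroE)
    have r1: "r dvd [:[:[:0, 1:], 1:]:]" and r2: "r dvd [:[:0, 1:], 1:]"
      using p1 p2 unfolding q1 q2 r const_poly_dvd_iff by (auto dest: spec[of _ 0])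
    have "degree r = 0" using dvd_imp_degree_le[OF r1] by simp
    then obtain s where s: "r = [:s:]" by (auto elim: degree_eq_zeroE)
    have "s dvd coeff [:[:0, 1:], 1:] 1" using r2 unfolding s const_poly_dvd_iff by blast
    thus ?thesis unfolding r s by (simp add: is_unit_poly_iff)
  next
    case False
    define q where "q = const4 l * (var_x + var_y + const4 k * var_t) - const4 k * (var_y + var_z + const4 l * var_t)"
    have "eval4 q 1 0 0 0 = l" "eval4 q 0 0 1 0 = - k" unfolding q_def by (simp_all add: eval4_hom eval4_vars)
    hence q0: "q \<noteq> 0" using False by (auto simp: eval4_hom)
    have "q = [:[:[:0,[:l:]:] + [:[:0,l:]:]:] - [:[:0,[:k:]:], [:[:k:]:]:]:]"
      unfolding q_def q1 q2 by (simp add: const4_def)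
    hence "degree q = 0" by simp
    moreover have "p dvd q" unfolding q_def using p1 p2 by (intro dvd_diff dvd_mult)
    ultimately have "degree p = 0" using dvd_imp_degree_le[of p q] q0 by simp
    then obtain r where r: "p = [:r:]" by (auto elim: degree_eq_zeroE)
    have "r dvd coeff [:[:[:[:0, 1:], 1:]:], [:[:[:k:]:]:]:] 1" "r dvd coeff [:[:[:0, 1:], 1:], [:[:[:l:]:]:]:] 1"
      using p1 p2 unfolding q1 q2 r const_poly_dvd_iff by blast+
    hence "r dvd [:[:[:k:]:]:]" "r dvd [:[:[:l:]:]:]" by simp_all
    moreover have "is_unit [:[:[:x:]:]:]" if "x \<noteq> 0" for x :: complex
      using that by (simp add: is_unit_poly_iff dvd_field_iff)
    ultimately have "is_unit r" using False dvd_unit_imp_unit by metis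
    thus ?thesis unfolding r by (simp add: is_unit_poly_iff)
  qed
qed

text \<open>Either equation would be an algebraic relation between the parameters. The second
  expression is, up to sign, the numerator of the coefficient \<open>\<beta>\<close> of the
  recurrence.\<close>

lemma independent4_neq0:
  assumes "independent4 a b c d"
  shows "d \<noteq> 0" "a * d - b * c + c^2 \<noteq> 0"
proof -
  define p where "p = (var_t :: cpoly4)"
  have "p \<noteq> 0" "\<forall>i j k l. coeff4 p i j k l \<in> \<rat>"
    unfolding p_def var_t_def coeff4_def by (auto simp: coeff_pCons one_pCons split: nat.splits)
  hence "eval4 p a b c d \<noteq> 0" using assms unfolding independent4_def by blast
  thus "d \<noteq> 0" by (simp add: p_def eval4_vars)
  define q where "q = var_x * var_t - var_y * var_z + var_z^2"
  have q: "q = [:[:0, [:0, -1:], 1:], [:[:[:0, 1:]:]:]:]"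
    unfolding q_def var_x_def var_t_def var_y_def var_z_def by (simp add: power2_eq_square one_pCons)
  have "q \<noteq> 0" "\<forall>i j k l. coeff4 q i j k l \<in> \<rat>"
    unfolding q coeff4_def by (auto simp: coeff_pCons one_pCons split: nat.splits)
  hence "eval4 q a b c d \<noteq> 0" using assms unfolding independent4_def by blast
  thus "a * d - b * c + c^2 \<noteq> 0" by (simp add: q_def eval4_hom eval4_vars)
qed

text \<open>Coprimality makes the gcd of \<open>h * p\<close> and \<open>h * s\<close> equal to
  \<open>h\<close> up to a unit, so exactly \<open>h\<close> is removed. A constant may survive
  because \<open>gcd\<close> is normalised.\<close>

lemma regularise_scale:
  assumes "h \<noteq> 0" "coprime p s"
  shows "\<exists>c. regularise (h * p, h * q, h * r, h * s) = (const4 c * p, const4 c * q, const4 c * r, const4 c * s) \<and> const4 c \<noteq> 0"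
proof -
  define g where "g = gcd (h * p) (gcd (h * q) (gcd (h * r) (h * s)))"
  have "h dvd g" unfolding g_def by simp
  then obtain u where u: "g = h * u" by (auto elim: dvdE)
  have "g dvd h * p" unfolding g_def by simp
  moreover have "g dvd h * s" unfolding g_def by (meson dvd_trans gcd_dvd2)
  ultimately have "g dvd gcd (h * p) (h * s)" by simp
  also have "gcd (h * p) (h * s) = normalize h" using assms(2) by (simp add: gcd_mult_left)
  finally have "g dvd h" by simp
  then obtain k where k: "h = g * k" by (auto elim: dvdE)
  have uk: "u * k = 1" using k assms(1) unfolding u by simp
  hence "is_unit k" by (metis dvd_triv_right)
  then obtain c where c: "k = const4 c" using unit_cpoly4 by blast
  have g0: "g \<noteq> 0" using k assms(1) by auto
  have "(h * x) div g = k * x" for x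
    unfolding k using g0 by (simp add: mult.assoc)
  hence "regularise (h * p, h * q, h * r, h * s) = (k * p, k * q, k * r, k * s)"
    by (simp add: g_def[symmetric] Let_def)
  moreover have "k \<noteq> 0" using uk by auto
  ultimately show ?thesis unfolding c by blast
qed

section \<open>The degree sequence\<close>

text \<open>The difference is taken in the integers, so that \<open>k = 0\<close> gives 1, the
  degree of \<open>V\<close>.\<close>

definition sg_degree :: "nat \<Rightarrow> nat" where
  "sg_degree k = nat ((int k - 2)^2 div 4)"

lemma sg_degree_even: "int (sg_degree (2 * r)) = (int r - 1)^2"
proof -
  have "(int (2 * r) - 2)^2 = 4 * (int r - 1)^2" by (simp add: power2_eq_square algebra_simps)
  thus ?thesis by (simp add: sg_degree_def)
qed

lemma sg_degree_odd: "int (sg_degree (2 * r + 1)) = int r * (int r - 1)"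
proof -
  have "(int (2 * r + 1) - 2)^2 = 4 * (int r * (int r - 1)) + 1" by (simp add: power2_eq_square algebra_simps)
  moreover have "int r * (int r - 1) \<ge> 0" by (cases "r = 0") auto
  ultimately show ?thesis by (simp add: sg_degree_def)
qed

lemma nat_parity_cases:
  obtains r where "k = 2 * r" | r where "k = 2 * r + (1::nat)"
  by (metis oddE evenE)

text \<open>The first two balance the terms of \<open>somos_rel\<close>, where \<open>t^2\<close>
  has degree 2 and \<open>J\<close> degree 3; the third says that w has degree 0.\<close>

lemma sg_degree_relations:
  "sg_degree (k + 5) + sg_degree k = sg_degree (k + 4) + sg_degree (k + 1) + 2"
  "sg_degree (k + 5) + sg_degree k = sg_degree (k + 3) + sg_degree (k + 2) + 3"
  "sg_degree (k + 3) + sg_degree k = sg_degree (k + 2) + sg_degree (k + 1) + 1"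
proof -
  have "int (sg_degree (k + 5) + sg_degree k) = int (sg_degree (k + 4) + sg_degree (k + 1) + 2) \<and>
    int (sg_degree (k + 5) + sg_degree k) = int (sg_degree (k + 3) + sg_degree (k + 2) + 3) \<and>
    int (sg_degree (k + 3) + sg_degree k) = int (sg_degree (k + 2) + sg_degree (k + 1) + 1)"
  proof (cases k rule: nat_parity_cases)
    case (1 r)
    have "k + 1 = 2 * r + 1" "k + 2 = 2 * (r + 1)" "k + 3 = 2 * (r + 1) + 1" "k + 4 = 2 * (r + 2)" "k + 5 = 2 * (r + 2) + 1"
      using 1 by auto
    thus ?thesis unfolding of_nat_add 1(1) by (simp only: sg_degree_even sg_degree_odd) (simp add: power2_eq_square algebra_simps)
  next
    case (2 r)
    have "k + 1 = 2 * (r + 1)" "k + 2 = 2 * (r + 1) + 1" "k + 3 = 2 * (r + 2)" "k + 4 = 2 * (r + 2) + 1" "k + 5 = 2 * (r + 3)"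
      using 2 by auto
    thus ?thesis using 2 unfolding of_nat_add by (simp only: sg_degree_even sg_degree_odd) (simp add: power2_eq_square algebra_simps)
  qed
  thus "sg_degree (k + 5) + sg_degree k = sg_degree (k + 4) + sg_degree (k + 1) + 2"
    "sg_degree (k + 5) + sg_degree k = sg_degree (k + 3) + sg_degree (k + 2) + 3"
    "sg_degree (k + 3) + sg_degree k = sg_degree (k + 2) + sg_degree (k + 1) + 1" by linarith+
qed

lemma sg_degree_init: "sg_degree 0 = 1" "sg_degree 1 = 0" "sg_degree 2 = 0" "sg_degree 3 = 0" "sg_degree 4 = 1"
  by (simp_all add: sg_degree_def)

definition sg_prod_degree :: "nat \<Rightarrow> nat" where "sg_prod_degree k = (\<Sum>j = 1..<k. sg_degree j)"

lemma sg_prod_degree_Suc: "sg_prod_degree (Suc (Suc k)) = sg_prod_degree (Suc k) + sg_degree (Suc k)"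
  by (simp add: sg_prod_degree_def)

text \<open>The increment is (n+2)^2/4 rounded down; its dependence on parity yields the alternating
  term.\<close>

lemma sg_prod_degree_closed_form:
  "real (1 + sg_prod_degree (n + 4)) = 17/16 + 5/12 * real n + 3/8 * real n ^ 2 + 1/12 * real n ^ 3 - 1/16 * (-1) ^ n"
proof (induction n)
  case 0
  have "sg_prod_degree (0 + 4) = sg_degree 1 + sg_degree 2 + sg_degree 3" by (simp add: sg_prod_degree_def eval_nat_numeral)
  thus ?case unfolding sg_degree_init by simp
next
  case (Suc n)
  have "sg_prod_degree (Suc n + 4) = sg_prod_degree (n + 4) + sg_degree (n + 4)"
    using sg_prod_degree_Suc[of "n + 3"] by (simp add: eval_nat_numeral)
  hence e: "real (1 + sg_prod_degree (Suc n + 4)) = real (1 + sg_prod_degree (n + 4)) + real_of_int (int (sg_degree (n + 4)))" by simp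
  show ?case
  proof (cases n rule: nat_parity_cases)
    case (1 r)
    have "n + 4 = 2 * (r + 2)" using 1 by simp
    have "int (sg_degree (n + 4)) = (int r + 1)^2" unfolding \<open>n + 4 = 2 * (r + 2)\<close> sg_degree_even by simp
    thus ?thesis unfolding e Suc using 1 by (simp add: power2_eq_square power3_eq_cube field_simps)
  next
    case (2 r)
    have "n + 4 = 2 * (r + 2) + 1" using 2 by simp
    have "int (sg_degree (n + 4)) = (int r + 2) * (int r + 1)" unfolding \<open>n + 4 = 2 * (r + 2) + 1\<close> sg_degree_odd by (simp add: algebra_simps)
    thus ?thesis unfolding e Suc using 2 by (simp add: power2_eq_square power3_eq_cube field_simps)
  qed
qed

section \<open>Specialisation to the map\<close>

locale phi_params =
  fixes a b c d :: complex
  assumes d_neq0: "d \<noteq> 0" and disc: "a * d - b * c + c^2 \<noteq> 0"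
begin

text \<open>The constants come from writing the map in terms of w = x + y + c/d, with x and y
  affine; they satisfy the hypotheses of \<open>phi_algebra\<close>.\<close>

definition \<gamma> where "\<gamma> = c / d"
definition \<alpha> where "\<alpha> = (4 * c - b) / d"
definition \<beta> where "\<beta> = - ((a * d - b * c + c^2) / d^2)"

abbreviation "U0 \<equiv> var_x + var_y + const4 \<gamma> * var_t"
abbreviation "V0 \<equiv> var_y + var_z + const4 \<gamma> * var_t"

sublocale somos5_complex U0 V0 var_t const4 \<alpha> \<beta>
proof
  show "\<not> var_t dvd U0 * V0 * (U0 + V0)"
  proof
    assume "var_t dvd U0 * V0 * (U0 + V0)"
    \<comment> \<open>At (1, 1, 1, 0) the product is 2 * 2 * 4.\<close>
    from var_t_dvd_eval4[OF this, of 1 1 1] show False by (simp add: eval4_hom eval4_vars eval4_numeral)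
  qed
  show "\<beta> \<noteq> 0" unfolding \<beta>_def using d_neq0 disc by simp
next
  fix p x y assume p: "prime_elem p" "p dvd U0 - const4 x * var_t" "p dvd V0 - const4 y * var_t"
  have "U0 - const4 x * var_t = var_x + var_y + const4 (\<gamma> - x) * var_t"
    "V0 - const4 y * var_t = var_y + var_z + const4 (\<gamma> - y) * var_t"
    by (simp_all add: const4_hom algebra_simps)
  with p linear_forms_coprime have "is_unit p" by metis
  thus False using p(1) prime_elem_not_unit by blast
qed (simp_all add: const4_hom prime_var_t)

abbreviation "xn \<equiv> xnum (const4 \<gamma>) var_z"

lemma phi_iterate_eq:
  "\<exists>h. h \<noteq> 0 \<and> phi_iterate a b c d n = scale_quad h (reduced_quad (const4 \<gamma>) var_z n)"
proof -
  have "reduced_quad (const4 \<gamma>) var_z 0 = (var_x, var_y, var_z, var_t)"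
  proof -
    have e: "0 + 2 = (2 :: nat)" "0 + 1 = (1 :: nat)" "0 + 3 = (3 :: nat)" "0 + 4 = (4 :: nat)" by auto
    have "sg_prod 4 = 1" by (simp add: sg_prod_def eval_nat_numeral)
    show ?thesis unfolding reduced_quad_def e xnum_1 xnum_2 sg_init xnum.simps(1) \<open>sg_prod 4 = 1\<close>
      by (simp add: algebra_simps)
  qed
  moreover have "const4 c = const4 d * const4 \<gamma>"
    using d_neq0 by (simp add: \<gamma>_def flip: const4_hom)
  moreover have "const4 d * const4 \<alpha> = 4 * const4 c - const4 b"
  proof -
    have "d * \<alpha> = 4 * c - b" using d_neq0 by (simp add: \<alpha>_def)
    hence "const4 (d * \<alpha>) = const4 (4 * c - b)" by simp
    thus ?thesis by (simp only: const4_hom const4_numeral)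
  qed
  moreover have "const4 d * const4 \<beta> = - (const4 a - const4 b * const4 \<gamma> + const4 d * (const4 \<gamma>)^2)"
  proof -
    have "d * \<beta> = - (a - b * \<gamma> + d * (\<gamma> * \<gamma>))" using d_neq0
      by (simp add: \<beta>_def \<gamma>_def field_simps power2_eq_square)
    hence "const4 (d * \<beta>) = const4 (- (a - b * \<gamma> + d * (\<gamma> * \<gamma>)))" by simp
    thus ?thesis by (simp only: const4_hom power2_eq_square)
  qed
  moreover have "const4 d \<noteq> 0" using d_neq0 by (simp add: const4_def)
  ultimately show ?thesis unfolding phi_iterate_def using phi_iterate_quad by metis
qed

section \<open>Values at a point of the hyperplane t = 0\<close>

abbreviation ep :: "cpoly4 \<Rightarrow> complex" where "ep p \<equiv> eval4 p 1 1 1 0"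

text \<open>On t = 0 the recurrence for t w says that three consecutive values sum to 0. The
  integers \<open>m\<close> and \<open>n\<close> are two such values; they start with 2, 2 and run
  through 2, 2, -4 periodically. Evenness is kept for the parity argument on
  \<open>xn\<close>.\<close>

lemma ep_sg:
  "ep (sg k) \<noteq> 0 \<and> ep (sg (k + 1)) \<noteq> 0 \<and> ep (sg (k + 2)) \<noteq> 0 \<and> ep (sg (k + 3)) \<noteq> 0 \<and>
   (\<exists>m n. even m \<and> even n \<and> m \<noteq> 0 \<and> n \<noteq> 0 \<and> m + n \<noteq> 0 \<and>
     ep (sg (k + 3)) * ep (sg k) = of_int m * (ep (sg (k + 2)) * ep (sg (k + 1))) \<and>
     ep (sg (k + 4)) * ep (sg (k + 1)) = of_int n * (ep (sg (k + 3)) * ep (sg (k + 2))))"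
proof (induction k)
  case 0
  have e: "0 + 1 = (1 :: nat)" "0 + 2 = (2 :: nat)" "0 + 3 = (3 :: nat)" "0 + 4 = (4 :: nat)" by auto
  show ?case unfolding e sg_init sg.simps(1)
    by (simp add: eval4_hom eval4_vars)
next
  case (Suc k)
  have i: "Suc k = k + 1" "k + 1 + 1 = k + 2" "k + 1 + 2 = k + 3" "k + 1 + 3 = k + 4" "k + 1 + 4 = k + 5" by auto
  define A where "A i = ep (sg (k + i))" for i
  have A0: "ep (sg k) = A 0" by (simp add: A_def)
  from Suc obtain m n where nz: "A 0 \<noteq> 0" "A 1 \<noteq> 0" "A 2 \<noteq> 0" "A 3 \<noteq> 0"
    and mn: "even m" "even n" "m \<noteq> 0" "n \<noteq> 0" "m + n \<noteq> 0"
    and rm: "A 3 * A 0 = of_int m * (A 2 * A 1)" and rn: "A 4 * A 1 = of_int n * (A 3 * A 2)"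
    unfolding A0 A_def[symmetric] by blast
  have A4: "A 4 \<noteq> 0" using rn nz mn by auto
  have "A 5 * A 2 ^ 2 * A 1 = - (A 4 ^ 2 * A 1 ^ 2) - A 4 * A 3 ^ 2 * A 0"
    using arg_cong[OF sum_rel[of k, unfolded sum_rel_def], of ep] unfolding A_def
    by (simp add: eval4_hom eval4_vars)
  also have "\<dots> = - (A 4 * A 1) * (A 4 * A 1) - A 4 * A 3 * (A 3 * A 0)"
    by (simp add: power2_eq_square mult_ac)
  also have "\<dots> = - (of_int n * (A 3 * A 2)) * (A 4 * A 1) - A 4 * A 3 * (of_int m * (A 2 * A 1))"
    unfolding rm rn[symmetric] ..
  also have "\<dots> = of_int (- n - m) * (A 4 * A 3) * (A 2 * A 1)"
    by (simp add: algebra_simps)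
  finally have "(A 5 * A 2) * (A 2 * A 1) = of_int (- n - m) * (A 4 * A 3) * (A 2 * A 1)"
    by (simp add: power2_eq_square mult_ac)
  hence r: "A 5 * A 2 = of_int (- n - m) * (A 4 * A 3)" using nz by simp
  have "even (- n - m)" "- n - m \<noteq> 0" "n + (- n - m) \<noteq> 0" using mn by auto
  hence "\<exists>m n. even m \<and> even n \<and> m \<noteq> 0 \<and> n \<noteq> 0 \<and> m + n \<noteq> 0 \<and>
     A 4 * A 1 = of_int m * (A 3 * A 2) \<and> A 5 * A 2 = of_int n * (A 4 * A 3)"
    using mn rn r by blast
  thus ?case unfolding i A_def[symmetric] using nz A4 by blast
qed

text \<open>All that matters is \<open>ep (xn k) \<noteq> 0\<close>; parity rules out a vanishing \<open>m\<close>.\<close>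

lemma ep_xnum: "\<exists>m. odd m \<and> ep (xn k) = of_int m * ep (sg_prod (k + 2))"
proof (induction k)
  case 0
  show ?case by (intro exI[of _ 1]) (simp add: eval4_vars eval4_hom sg_prod_def)
next
  case (Suc k)
  then obtain m where m: "odd m" "ep (xn k) = of_int m * ep (sg_prod (k + 2))" by blast
  obtain n where n: "even n" "ep (sg (k + 3)) * ep (sg k) = of_int n * (ep (sg (k + 2)) * ep (sg (k + 1)))"
    using ep_sg[of k] by blast
  have e: "Suc k + 2 = k + 3" by simp
  have "ep (xn (Suc k)) = - ep (sg (k + 2)) * ep (xn k) + ep (sg (k + 3)) * ep (sg k) * ep (sg_prod (k + 1))"
    unfolding xnum.simps(2) by (simp only: eval4_hom eval4_vars) simp
  also have "\<dots> = of_int (n - m) * ep (sg_prod (Suc k + 2))"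
    unfolding e m(2) n(2) sg_prod_steps(1,2) eval4_hom by (simp add: algebra_simps)
  finally show ?case using m n by (intro exI[of _ "n - m"]) auto
qed

lemma ep_sg_prod: "ep (sg_prod k) \<noteq> 0"
proof (induction k)
  case (Suc k)
  show ?case
  proof (cases k)
    case (Suc l)
    thus ?thesis using Suc.IH ep_sg[of "Suc l"] by (simp add: sg_prod_Suc eval4_hom)
  qed (simp add: sg_prod_def eval4_hom)
qed (simp add: sg_prod_def eval4_hom)

lemma var_t_ndvd_xnum: "\<not> var_t dvd xn k"
proof
  assume "var_t dvd xn k"
  hence "ep (xn k) = 0" by (rule var_t_dvd_eval4)
  thus False using ep_xnum[of k] ep_sg_prod[of "k + 2"] by auto
qed

lemma coprime_xnum: "coprime (xn (n + 2)) (var_t * sg_prod (n + 4))"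
proof (rule coprimeI_primes)
  fix p assume p: "prime_elem p" "p dvd xn (n + 2)" "p dvd var_t * sg_prod (n + 4)"
  show False
  proof (cases "p dvd var_t")
    case True
    thus False using prime_common[OF p(1) True p(2)] var_t_ndvd_xnum by blast
  next
    case False
    hence "p dvd sg_prod (n + 2 + 2)" using p by (simp add: prime_elem_dvd_mult_iff eval_nat_numeral)
    thus False using xnum_sg_prod_coprime[OF p(1)] p(2) by blast
  qed
qed (use sg_prod_neq0 t_neq0 in auto)

section \<open>Homogeneity and degrees\<close>

lemma homogeneous4_UV: "homogeneous4 1 U0" "homogeneous4 1 V0"
  using homogeneous4_mult[OF homogeneous4_const4[of \<gamma>] homogeneous4_var(4)]
  by (intro homogeneous4_add homogeneous4_var; simp)+

lemma homogeneous4_J: "homogeneous4 3 J"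
proof -
  note m = homogeneous4_mult
  note t = homogeneous4_var(4)
  have a: "homogeneous4 1 (const4 \<alpha> * var_t)" using m[OF homogeneous4_const4 t] by simp
  have "homogeneous4 (0 + (1 + 1) + 1) (const4 \<beta> * (var_t * var_t) * (U0 + V0))"
    by (intro m homogeneous4_const4 t homogeneous4_add[OF homogeneous4_UV])
  moreover have "homogeneous4 (1 + 1 + 1) (U0 * V0 * (U0 + V0 - const4 \<alpha> * var_t))"
    by (intro m homogeneous4_UV homogeneous4_diff homogeneous4_add a)
  ultimately have "homogeneous4 3 (U0 * V0 * (U0 + V0 - const4 \<alpha> * var_t) - const4 \<beta> * (var_t * var_t) * (U0 + V0))"
    by (intro homogeneous4_diff) (simp_all add: eval_nat_numeral)
  thus ?thesis unfolding J_def power2_eq_square .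
qed

text \<open>\<open>somos_rel\<close> gives the product \<open>sg (j + 5) * sg j\<close> as a
  homogeneous polynomial, and a quotient by a nonzero homogeneous factor stays homogeneous.\<close>

lemma homogeneous4_sg: "homogeneous4 (sg_degree k) (sg k)"
proof (induction k rule: less_induct)
  case (less k)
  have "k = 0 \<or> k = 1 \<or> k = 2 \<or> k = 3 \<or> k = 4 \<or> k = (k - 5) + 5" by auto
  then consider "k = 0" | "k = 1 \<or> k = 2 \<or> k = 3" | "k = 4" | j where "k = j + 5" by blast
  thus ?case
  proof cases
    case 4
    note IH = less[unfolded 4]
    note m = homogeneous4_mult
    have "homogeneous4 (0 + (1 + 1) + sg_degree (j + 4) + sg_degree (j + 1)) (- const4 \<beta> * (var_t * var_t) * sg (j + 4) * sg (j + 1))"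
      by (intro m homogeneous4_uminus homogeneous4_const4 homogeneous4_var IH) auto
    hence 1: "homogeneous4 (sg_degree (j + 5) + sg_degree j) (- const4 \<beta> * var_t^2 * sg (j + 4) * sg (j + 1))"
      unfolding sg_degree_relations(1) power2_eq_square by (simp add: ac_simps)
    have "homogeneous4 (3 + sg_degree (j + 3) + sg_degree (j + 2)) (J * sg (j + 3) * sg (j + 2))"
      by (intro m homogeneous4_J IH) auto
    hence 2: "homogeneous4 (sg_degree (j + 5) + sg_degree j) (J * sg (j + 3) * sg (j + 2))"
      unfolding sg_degree_relations(2) by (simp add: ac_simps)
    have "homogeneous4 (sg_degree (j + 5) + sg_degree j) (sg (j + 5) * sg j)"
      using homogeneous4_diff[OF 1 2] somos_rel[of j] unfolding somos_rel_def by simp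
    thus ?thesis unfolding 4 by (rule homogeneous4_quotient[OF _ IH sg_neq0]) simp
  qed (use sg_init homogeneous4_1 homogeneous4_UV in \<open>auto simp only: sg_degree_init sg.simps(1)\<close>)
qed

lemma homogeneous4_sg_prod: "homogeneous4 (sg_prod_degree k) (sg_prod k)"
proof (induction k)
  case (Suc k)
  show ?case
  proof (cases k)
    case (Suc l)
    thus ?thesis using Suc.IH homogeneous4_mult[OF _ homogeneous4_sg] by (simp only: sg_prod_Suc sg_prod_degree_Suc)
  qed (simp add: sg_prod_def sg_prod_degree_def homogeneous4_1)
qed (simp add: sg_prod_def sg_prod_degree_def homogeneous4_1)

lemma sg_prod_degree_steps: "sg_prod_degree (k + 2) = sg_prod_degree (k + 1) + sg_degree (k + 1)" "sg_prod_degree (k + 3) = sg_prod_degree (k + 2) + sg_degree (k + 2)"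
   "sg_prod_degree (k + 4) = sg_prod_degree (k + 3) + sg_degree (k + 3)"
  using sg_prod_degree_Suc[of k] sg_prod_degree_Suc[of "k + 1"] sg_prod_degree_Suc[of "k + 2"] by (simp_all add: eval_nat_numeral)

lemma homogeneous4_xnum: "homogeneous4 (1 + sg_prod_degree (k + 2)) (xn k)"
proof (induction k)
  case 0
  show ?case using homogeneous4_var(3) sg_degree_init by (simp add: sg_prod_degree_def eval_nat_numeral)
next
  case (Suc k)
  note m = homogeneous4_mult
  have e: "1 + sg_prod_degree (Suc k + 2) = sg_degree (k + 2) + (1 + sg_prod_degree (k + 2))"
    "1 + sg_prod_degree (Suc k + 2) = sg_degree (k + 3) + sg_degree k + sg_prod_degree (k + 1)"
    "1 + sg_prod_degree (Suc k + 2) = 0 + 1 + sg_prod_degree (k + 3)"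
    using sg_prod_degree_steps[of k] sg_degree_relations(3)[of k] by (simp_all add: eval_nat_numeral)
  have 1: "homogeneous4 (1 + sg_prod_degree (Suc k + 2)) (- sg (k + 2) * xn k)"
    unfolding e(1) by (intro m homogeneous4_uminus homogeneous4_sg Suc)
  have 2: "homogeneous4 (1 + sg_prod_degree (Suc k + 2)) (sg (k + 3) * sg k * sg_prod (k + 1))"
    unfolding e(2) by (intro m homogeneous4_sg homogeneous4_sg_prod)
  have 3: "homogeneous4 (1 + sg_prod_degree (Suc k + 2)) (const4 \<gamma> * var_t * sg_prod (k + 3))"
    unfolding e(3) by (intro m homogeneous4_const4 homogeneous4_var homogeneous4_sg_prod)
  show ?case unfolding xnum.simps(2) by (intro homogeneous4_diff homogeneous4_add 1 2 3)
qed

text \<open>The first and last reduced coordinates are coprime, so regularising leaves the reduced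
  quadruple up to a constant. Its nonzero last coordinate \<open>t * sg_prod (n + 4)\<close> fixes
  the degree.\<close>

lemma iterate_degree_eq: "iterate_degree a b c d n = 1 + sg_prod_degree (n + 4)"
proof -
  let ?m = "1 + sg_prod_degree (n + 4)"
  obtain h where h: "h \<noteq> 0" "phi_iterate a b c d n = scale_quad h (reduced_quad (const4 \<gamma>) var_z n)"
    using phi_iterate_eq by blast
  define q1 q2 q3 q4 where q: "q1 = xn (n + 2)" "q2 = xn (n + 1) * sg (n + 3)" "q3 = xn n * sg (n + 3) * sg (n + 2)"
    "q4 = var_t * sg_prod (n + 4)"
  obtain u where u: "regularise (h * q1, h * q2, h * q3, h * q4) = (const4 u * q1, const4 u * q2, const4 u * q3, const4 u * q4)" "const4 u \<noteq> 0"
    using regularise_scale[OF h(1) coprime_xnum[of n]] unfolding q by blast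
  have reg: "regularise (phi_iterate a b c d n) = (const4 u * q1, const4 u * q2, const4 u * q3, const4 u * q4)"
    using u(1) h(2) unfolding reduced_quad_def q[symmetric] scale_quad.simps by (simp only:)
  have i: "n + 2 + 2 = n + 4" "n + 1 + 2 = n + 3" by auto
  have H1: "homogeneous4 ?m q1" using homogeneous4_xnum[of "n + 2"] unfolding q i .
  have H2: "homogeneous4 ?m q2"
    using homogeneous4_mult[OF homogeneous4_xnum[of "n + 1"] homogeneous4_sg[of "n + 3"]] unfolding q i
    by (simp add: sg_prod_degree_steps)
  have H3: "homogeneous4 ?m q3"
    using homogeneous4_mult[OF homogeneous4_mult[OF homogeneous4_xnum[of n] homogeneous4_sg[of "n + 3"]] homogeneous4_sg[of "n + 2"]]
    unfolding q i by (simp add: sg_prod_degree_steps ac_simps)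
  have H4: "homogeneous4 ?m q4"
    using homogeneous4_mult[OF homogeneous4_var(4) homogeneous4_sg_prod[of "n + 4"]] unfolding q .
  have H: "homogeneous4 ?m (const4 u * p)" if "homogeneous4 ?m p" for p
    using homogeneous4_mult[OF homogeneous4_const4 that] by simp
  have "homogeneous_quad ?m (regularise (phi_iterate a b c d n))"
    unfolding reg using H H1 H2 H3 H4 by simp
  moreover have "k = ?m" if "homogeneous_quad k (regularise (phi_iterate a b c d n))" for k
  proof -
    have "homogeneous4 k (const4 u * q4)" using that unfolding reg by simp
    moreover have "const4 u * q4 \<noteq> 0" using u(2) sg_prod_neq0 t_neq0 unfolding q by simp
    ultimately show ?thesis using homogeneous4_unique H[OF H4] by blast
  qed
  ultimately show ?thesis unfolding iterate_degree_def by (rule the_equality)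
qed

end

theorem theorem3:
  fixes a b c d :: complex and n :: nat
  assumes "independent4 a b c d"
  shows "real (iterate_degree a b c d n) =
    17/16 + 5/12 * real n + 3/8 * real n ^ 2 + 1/12 * real n ^ 3 - 1/16 * (-1) ^ n"
proof -
  interpret phi_params a b c d
    by unfold_locales (use independent4_neq0[OF assms] in auto)
  show ?thesis using sg_prod_degree_closed_form[of n] iterate_degree_eq[of n] by simp
qed

end
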